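(* Let $f$ be a centered Gaussian field over $\mathbb{R}^2$ satisfying conditions (Symmetries), (Strong regularity), (Weak positivity of correlations) and (Strong decay of correlations) defined in the context. Let $\sigma_0=\frac12(1+\mathrm{sign}(f))$, where the sign of $0$ is taken to be $-1$. For $R>1$ let $\mathrm{Cross}_0(A_R)$ be the event that there exists a continuous path included in $\{\sigma_0=0\}$ crossing the annulus $A_R=B(0,R)\setminus B(0,1)$, i.e. joining $S(0,1)$ to $S(0,R)$. Then $$\forall\eta>0,\quad\limsup_{R\to\infty}R^{1+\eta}\,\mathbb{P}[\mathrm{Cross}_0(A_R)]>0.$$
   Context: Let $f$ be a centered Gaussian field on $\mathbb{R}^2$ with covariance $e(x,y)=\mathbb{E}(f(x)f(y))$. It is assumed stationary, $e(x,y)=\kappa(x-y)$, with $\kappa$ continuous, so that $\kappa$ is the Fourier transform of a spectral measure $m$; it is assumed that $m$ is absolutely continuous with respect to Lebesgue measure, $dm(x)=\rho^2(x)\,dx$ with $\rho:\mathbb{R}^2\to\mathbb{R}$. Let $q=\mathcal{F}[\rho]$ be the Fourier transform of $\rho$ (normalised so that $\kappa=q\star q$). - (Symmetries) $f$ is centered and stationary, $\kappa(0)=1$, and $\kappa$ is symmetric under both reflection in the $x$-axis and rotation by $\pi/2$ about the origin. - (Strong regularity) $q$ is in $L^2(\mathbb{R}^2)$, $C^3$ and even, and the support of $\rho$ contains a neighbourhood of $0$. - (Weak positivity of correlations) $\kappa=q\star q\ge0$. - (Strong decay of correlations) There exist $C,\beta>0$ such that for every multi-index $\alpha$ with $|\alpha|\le3$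 and every $x\in\mathbb{R}^2$, $|\partial^\alpha q(x)|\le C\exp(-\|x\|^\beta)$. $B(0,r)$ and $S(0,r)$ are the Euclidean ball and sphere. *)

theory Defs
  imports "HOL-Probability.Probability"
begin

section \<open>Gaussian fields on the plane\<close>

text \<open>Constants count as (degenerate) Gaussian variables.\<close>

definition gaussian_rv :: "'w measure \<Rightarrow> ('w \<Rightarrow> real) \<Rightarrow> bool" where
  "gaussian_rv M X \<longleftrightarrow> X \<in> borel_measurable M \<and>
     (\<exists>\<mu>. (AE \<omega> in M. X \<omega> = \<mu>) \<or>
          (\<exists>\<sigma>>0. distributed M lborel X (normal_density \<mu> \<sigma>)))"

definition gaussian_field :: "'w measure \<Rightarrow> (real^2 \<Rightarrow> 'w \<Rightarrow> real) \<Rightarrow> bool" where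
  "gaussian_field M f \<longleftrightarrow>
     (\<forall>S c. finite S \<longrightarrow> gaussian_rv M (\<lambda>\<omega>. \<Sum>x\<in>S. c x * f x \<omega>))"

definition centered_field :: "'w measure \<Rightarrow> (real^2 \<Rightarrow> 'w \<Rightarrow> real) \<Rightarrow> bool" where
  "centered_field M f \<longleftrightarrow> (\<forall>x. integral\<^sup>L M (f x) = 0)"

definition stationary_covariance ::
  "'w measure \<Rightarrow> (real^2 \<Rightarrow> 'w \<Rightarrow> real) \<Rightarrow> (real^2 \<Rightarrow> real) \<Rightarrow> bool" where
  "stationary_covariance M f \<kappa> \<longleftrightarrow>
     (\<forall>x y. integral\<^sup>L M (\<lambda>\<omega>. f x \<omega> * f y \<omega>) = \<kappa> (x - y))"


section \<open>Fourier transform, spectral measure, convolution\<close>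

text \<open>
  The factor $2 \pi$ sits in the exponent.  With this convention the Fourier transform
  exchanges products and convolutions without any constant, so that the transform $\kappa$ of
  $\rho^2$ equals $q \star q$ for $q$ the transform of $\rho$.
\<close>

definition fourier_measure :: "(real^2) measure \<Rightarrow> real^2 \<Rightarrow> complex" where
  "fourier_measure m x = integral\<^sup>L m (\<lambda>\<xi>. cis (- (2 * pi * (x \<bullet> \<xi>))))"

definition fourier_fun :: "(real^2 \<Rightarrow> real) \<Rightarrow> real^2 \<Rightarrow> complex" where
  "fourier_fun g x = integral\<^sup>L lborel (\<lambda>\<xi>. cis (- (2 * pi * (x \<bullet> \<xi>))) * of_real (g \<xi>))"

definition is_spectral_measure :: "(real^2) measure \<Rightarrow> (real^2 \<Rightarrow> real) \<Rightarrow> bool" where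
  "is_spectral_measure m \<kappa> \<longleftrightarrow>
     finite_measure m \<and> sets m = sets borel \<and> (\<forall>x. of_real (\<kappa> x) = fourier_measure m x)"

text \<open>
  A density $\rho^2$ of a finite measure only gives $\rho \in L^2$, so the transform of $\rho$
  is the Plancherel one: the $L^2$ limit of the transforms of the truncations of $\rho$ to
  balls.  The function $q$ is real-valued because the transform of a real $\rho$ is Hermitian
  and $q$ is assumed to be even.
\<close>

definition is_fourier_L2 :: "(real^2 \<Rightarrow> real) \<Rightarrow> (real^2 \<Rightarrow> real) \<Rightarrow> bool" where
  "is_fourier_L2 \<rho> q \<longleftrightarrow>
     (\<lambda>n::nat. \<integral>\<^sup>+x. ennreal ((cmod (of_real (q x)
          - fourier_fun (\<lambda>\<xi>. indicator (ball 0 (real n)) \<xi> * \<rho> \<xi>) x))\<^sup>2) \<partial>lborel)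
     \<longlonglongrightarrow> 0"

definition convolve :: "(real^2 \<Rightarrow> real) \<Rightarrow> (real^2 \<Rightarrow> real) \<Rightarrow> real^2 \<Rightarrow> real" where
  "convolve g h x = integral\<^sup>L lborel (\<lambda>y. g y * h (x - y))"

text \<open>
  Since $\rho$ is a density, its support is the essential one, i.e. the support of the measure
  $|\rho(x)|\,dx$.  It agrees with the closure of $\{\rho \neq 0\}$ when $\rho$ is continuous.
\<close>

definition ess_support :: "(real^2 \<Rightarrow> real) \<Rightarrow> (real^2) set" where
  "ess_support \<rho> = {x. \<forall>r>0. \<not> (AE y in lborel. y \<in> ball x r \<longrightarrow> \<rho> y = 0)}"


section \<open>Partial derivatives\<close>

definition partial_deriv :: "2 \<Rightarrow> (real^2 \<Rightarrow> real) \<Rightarrow> real^2 \<Rightarrow> real" where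
  "partial_deriv i g x = frechet_derivative g (at x) (axis i 1)"

primrec C_k :: "nat \<Rightarrow> (real^2 \<Rightarrow> real) \<Rightarrow> bool" where
  "C_k 0 g \<longleftrightarrow> continuous_on UNIV g"
| "C_k (Suc k) g \<longleftrightarrow> g differentiable_on UNIV \<and> (\<forall>i. C_k k (partial_deriv i g))"

definition multi_deriv :: "nat \<Rightarrow> nat \<Rightarrow> (real^2 \<Rightarrow> real) \<Rightarrow> real^2 \<Rightarrow> real" where
  "multi_deriv a b g = (partial_deriv 1 ^^ a) ((partial_deriv 2 ^^ b) g)"


section \<open>The conditions on the field\<close>

definition symmetries ::
  "'w measure \<Rightarrow> (real^2 \<Rightarrow> 'w \<Rightarrow> real) \<Rightarrow> (real^2 \<Rightarrow> real) \<Rightarrow> bool" where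
  "symmetries M f \<kappa> \<longleftrightarrow>
     centered_field M f \<and> stationary_covariance M f \<kappa> \<and> \<kappa> 0 = 1 \<and>
     (\<forall>x. \<kappa> (vector [x $ 1, - (x $ 2)]) = \<kappa> x) \<and>
     (\<forall>x. \<kappa> (vector [- (x $ 2), x $ 1]) = \<kappa> x)"

definition strong_regularity :: "(real^2 \<Rightarrow> real) \<Rightarrow> (real^2 \<Rightarrow> real) \<Rightarrow> bool" where
  "strong_regularity \<rho> q \<longleftrightarrow>
     integrable lborel (\<lambda>x. (q x)\<^sup>2) \<and> C_k 3 q \<and> (\<forall>x. q (- x) = q x) \<and>
     (\<exists>r>0. ball 0 r \<subseteq> ess_support \<rho>)"

definition weak_positivity :: "(real^2 \<Rightarrow> real) \<Rightarrow> bool" where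
  "weak_positivity \<kappa> \<longleftrightarrow> (\<forall>x. \<kappa> x \<ge> 0)"

definition strong_decay :: "(real^2 \<Rightarrow> real) \<Rightarrow> bool" where
  "strong_decay q \<longleftrightarrow>
     (\<exists>C>0. \<exists>\<beta>>0. \<forall>a b. a + b \<le> 3 \<longrightarrow>
        (\<forall>x. \<bar>multi_deriv a b q x\<bar> \<le> C * exp (- (norm x powr \<beta>))))"


section \<open>Crossings\<close>

text \<open>In contrast to \<^const>\<open>sgn\<close>, the sign of $0$ is $-1$ here.\<close>

definition sign_neg :: "real \<Rightarrow> real" where
  "sign_neg t = (if t > 0 then 1 else -1)"

definition sigma0 :: "(real^2 \<Rightarrow> 'w \<Rightarrow> real) \<Rightarrow> 'w \<Rightarrow> real^2 \<Rightarrow> real" where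
  "sigma0 f \<omega> x = (1 + sign_neg (f x \<omega>)) / 2"

text \<open>
  A path joining the two spheres contains a subpath that does so inside the closed annulus,
  so confining the path to the annulus would give the same event.
\<close>

definition cross0 :: "'w measure \<Rightarrow> (real^2 \<Rightarrow> 'w \<Rightarrow> real) \<Rightarrow> real \<Rightarrow> 'w set" where
  "cross0 M f R = {\<omega> \<in> space M. \<exists>\<gamma>. path \<gamma> \<and> path_image \<gamma> \<subseteq> {x. sigma0 f \<omega> x = 0} \<and>
     pathstart \<gamma> \<in> sphere 0 1 \<and> pathfinish \<gamma> \<in> sphere 0 R}"

text \<open>
  For a field with almost surely continuous sample paths this event is the preimage of an
  analytic set of continuous functions, up to a null set; hence its probability is taken in
  the completion of $M$.
\<close>

definition prob_cross0 :: "'w measure \<Rightarrow> (real^2 \<Rightarrow> 'w \<Rightarrow> real) \<Rightarrow> real \<Rightarrow> real" where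
  "prob_cross0 M f R = measure (completion M) (cross0 M f R)"

end

theory Submission
  imports Defs
begin

text \<open>
  On a square of side \<open>R\<close>, either \<open>{f < \<epsilon>}\<close> contains a path between the left and right sides or
  \<open>{- f < \<epsilon>}\<close> contains one between the bottom and top sides. Such a path starts at distance at most
  \<open>1\<close> from one of about \<open>R\<close> points on a side and then reaches distance \<open>R\<close> from that point. Since
  \<open>f\<close> is stationary and \<open>- f\<close> has the law of \<open>f\<close>, the union bound gives a crossing probability of at
  least a constant times \<open>1 / R\<close>. To pass from \<open>\<epsilon> > 0\<close> to \<open>0\<close> (and to
  see that the crossing event is measurable), \<open>\<epsilon>\<close> is replaced by a multiple of
  \<open>h x = (\<Sum>p\<in>P. \<kappa> (x - p))\<close>, which is nonnegative, positive on a large ball for suitable finite \<open>P\<close>,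
  and a Cameron--Martin direction of \<open>f\<close>: along \<open>f + z h\<close> at most one value of \<open>z\<close> is exceptional.
\<close>

section \<open>Crossings\<close>

text \<open>At a zero of \<open>a\<close> the product is squeezed by \<open>\<bar>a\<bar>\<close>,
  whatever the jumps of \<open>s\<close>; elsewhere \<open>s\<close> is constant nearby.\<close>

lemma continuous_on_locally_constant_sign:
  fixes a s :: "'a::metric_space \<Rightarrow> real"
  assumes cont: "continuous_on Q a" and s: "\<And>x. \<bar>s x\<bar> \<le> 1"
    and loc: "\<And>x. x \<in> Q \<Longrightarrow> a x \<noteq> 0 \<Longrightarrow> eventually (\<lambda>y. s y = s x) (at x within Q)"
  shows "continuous_on Q (\<lambda>x. a x * s x)"
  unfolding continuous_on_def
proof
  fix x assume x: "x \<in> Q"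
  have lim: "(a \<longlongrightarrow> a x) (at x within Q)"
    using cont x by (auto simp: continuous_on_def)
  show "((\<lambda>x. a x * s x) \<longlongrightarrow> a x * s x) (at x within Q)"
  proof (cases "a x = 0")
    case True
    have "((\<lambda>x. a x * s x) \<longlongrightarrow> 0) (at x within Q)"
    proof (rule Lim_null_comparison)
      show "\<forall>\<^sub>F y in at x within Q. norm (a y * s y) \<le> \<bar>a y\<bar>"
        using s by (intro always_eventually) (simp add: abs_mult mult_left_le)
      show "((\<lambda>y. \<bar>a y\<bar>) \<longlongrightarrow> 0) (at x within Q)"
        using lim True tendsto_rabs_zero by fastforce
    qed
    then show ?thesis using True by simp
  next
    case False
    have "((\<lambda>y. a y * s x) \<longlongrightarrow> a x * s x) (at x within Q)"
      by (intro tendsto_intros lim)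
    moreover have "\<forall>\<^sub>F y in at x within Q. a y * s x = a y * s y"
      using loc[OF x False] by eventually_elim simp
    ultimately show ?thesis by (rule Lim_transform_eventually)
  qed
qed

text \<open>Brouwer's theorem applied to \<open>x + p x\<close> clamped to the cube. At a fixed
  point, \<open>p i x\<close> could be nonzero only if clamping hides it, with
  \<open>p i x < 0\<close> on the lower face or \<open>p i x > 0\<close> on the upper one; the
  boundary signs exclude both.\<close>

lemma poincare_miranda:
  fixes p :: "'n::finite \<Rightarrow> real^'n \<Rightarrow> real"
  assumes L: "0 \<le> L"
    and cont: "\<And>i. continuous_on (cbox 0 (vec L)) (p i)"
    and lo: "\<And>i x. x \<in> cbox 0 (vec L) \<Longrightarrow> x $ i = 0 \<Longrightarrow> 0 \<le> p i x"
    and hi: "\<And>i x. x \<in> cbox 0 (vec L) \<Longrightarrow> x $ i = L \<Longrightarrow> p i x \<le> 0"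
  shows "\<exists>x\<in>cbox 0 (vec L). \<forall>i. p i x = 0"
proof -
  let ?Q = "cbox 0 (vec L) :: (real^'n) set"
  define F where "F x = (\<chi> i. min L (max 0 (x $ i + p i x)))" for x
  have "continuous_on ?Q F"
    unfolding F_def by (intro continuous_intros cont continuous_on_vec_lambda)
  moreover have "F \<in> ?Q \<rightarrow> ?Q"
    using L by (auto simp: F_def mem_box_cart)
  moreover have "?Q \<noteq> {}"
    using L by (auto simp: interval_ne_empty_cart)
  ultimately obtain x where x: "x \<in> ?Q" "F x = x"
    using brouwer[of ?Q F] compact_cbox convex_box(1) by metis
  have "p i x = 0" for i
  proof -
    have "min L (max 0 (x $ i + p i x)) = x $ i"
      using x(2) by (simp add: F_def vec_eq_iff)
    moreover have "0 \<le> x $ i" "x $ i \<le> L"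
      using x(1) by (auto simp: mem_box_cart)
    ultimately show ?thesis
      using lo[OF x(1), of i] hi[OF x(1), of i] by (auto simp: min_def max_def split: if_splits)
  qed
  with x(1) show ?thesis by blast
qed

text \<open>If there is no crossing, let \<open>s i\<close> be \<open>1\<close> on the part of \<open>{a i > 0}\<close> that is reachable
  from the \<open>i\<close>-th lower face, and \<open>-1\<close> elsewhere. The field with components
  \<open>a i * s i\<close> is continuous and satisfies the boundary conditions of the Poincare--Miranda
  theorem, but it has no zero.\<close>

lemma square_crossing:
  fixes a :: "'n::finite \<Rightarrow> real^'n \<Rightarrow> real"
  assumes L: "0 \<le> L"
    and cont: "\<And>i. continuous_on (cbox 0 (vec L)) (a i)"
    and nn: "\<And>i x. 0 \<le> a i x"
    and cover: "\<And>x. x \<in> cbox 0 (vec L) \<Longrightarrow> \<exists>i. 0 < a i x"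
  obtains i g where "path g" "path_image g \<subseteq> {x \<in> cbox 0 (vec L). 0 < a i x}"
    "pathstart g $ i = 0" "pathfinish g $ i = L"
proof -
  let ?Q = "cbox 0 (vec L) :: (real^'n) set"
  define U where "U i = {x \<in> ?Q. 0 < a i x}" for i
  define V where "V i = {x. \<exists>l. l $ i = 0 \<and> path_component (U i) l x}" for i
  define s where "s i x = (if x \<in> V i then 1 else - 1 :: real)" for i x
  have "\<exists>i x. x \<in> V i \<and> x $ i = L"
  proof (rule ccontr)
    assume no: "\<not> (\<exists>i x. x \<in> V i \<and> x $ i = L)"
    have "\<exists>x\<in>?Q. \<forall>i. a i x * s i x = 0"
    proof (rule poincare_miranda[OF L])
      fix i x assume x: "x \<in> ?Q" "x $ i = 0"
      show "0 \<le> a i x * s i x"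
      proof (cases "a i x = 0")
        case False
        then have "x \<in> U i" using nn[of i x] x by (simp add: U_def)
        then have "x \<in> V i"
          using x by (auto simp: V_def intro!: exI[of _ x] path_component_refl)
        then show ?thesis using nn by (simp add: s_def)
      qed simp
    next
      fix i x assume "x \<in> ?Q" "x $ i = L"
      then show "a i x * s i x \<le> 0" using no nn by (auto simp: s_def)
    next
      fix i
      show "continuous_on ?Q (\<lambda>x. a i x * s i x)"
      proof (rule continuous_on_locally_constant_sign[OF cont])
        fix x assume x: "x \<in> ?Q" "a i x \<noteq> 0"
        then have "0 < a i x" using nn[of i x] by simp
        moreover have "(a i \<longlongrightarrow> a i x) (at x within ?Q)"
          using cont x by (auto simp: continuous_on_def)
        ultimately have "\<forall>\<^sub>F y in at x within ?Q. 0 < a i y"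
          by (simp add: order_tendstoD)
        then obtain d where d: "d > 0" "\<And>y. y \<in> ?Q \<Longrightarrow> y \<noteq> x \<Longrightarrow> dist y x < d \<Longrightarrow> 0 < a i y"
          by (auto simp: eventually_at)
        \<comment> \<open>This convex neighbourhood lies in \<open>U i\<close>, so all its points
          are reachable from the lower face as soon as one is; hence \<open>s i\<close> is constant
          on it.\<close>
        have sub: "ball x d \<inter> ?Q \<subseteq> U i"
          using d \<open>0 < a i x\<close> by (auto simp: U_def dist_commute) metis
        have conv: "convex (ball x d \<inter> ?Q)"
          by (intro convex_Int convex_ball convex_box)
        have "s i y = s i x" if y: "y \<in> ?Q" "dist y x < d" for y
        proof -
          have "path_connected (ball x d \<inter> ?Q)"
            using conv by (rule convex_imp_path_connected)
          then have "path_component (ball x d \<inter> ?Q) x y"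
            using x y d by (simp add: path_connected_component dist_commute)
          then have "path_component (U i) x y" "path_component (U i) y x"
            using sub path_component_of_subset path_component_sym by blast+
          then have "x \<in> V i \<longleftrightarrow> y \<in> V i"
            unfolding V_def using path_component_trans by blast
          then show ?thesis by (simp add: s_def)
        qed
        then show "\<forall>\<^sub>F y in at x within ?Q. s i y = s i x"
          using d by (auto simp: eventually_at)
      qed (simp add: s_def)
    qed
    then obtain x where "x \<in> ?Q" "\<And>i. a i x * s i x = 0" by auto
    moreover have "s i x \<noteq> 0" for i by (simp add: s_def)
    ultimately show False using cover[of x] by (metis mult_eq_0_iff less_irrefl)
  qed
  then obtain i x l where l: "path_component (U i) l x" "l $ i = 0" "x $ i = L"
    by (auto simp: V_def)
  then obtain g where "path g" "path_image g \<subseteq> U i" "pathstart g = l" "pathfinish g = x"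
    by (auto simp: path_component_def)
  with l show thesis by (intro that[of g i]) (auto simp: U_def)
qed

text \<open>By connectedness the path meets the inner sphere. The part before such a point is
  dropped, and the rest is stopped when it first reaches the frontier of \<open>ball c R\<close>,
  which keeps it in the closed ball.\<close>

lemma path_crossing_annulus:
  fixes g :: "real \<Rightarrow> 'a::real_normed_vector"
  assumes g: "path g" "dist c (pathstart g) \<le> r" "R \<le> dist c (pathfinish g)" and rR: "r < R" "0 < r"
  obtains h where "path h" "path_image h \<subseteq> path_image g \<inter> cball c R"
    "pathstart h \<in> sphere c r" "pathfinish h \<in> sphere c R"
proof -
  have "connected (path_image g)" using g by blast
  then have "connected (dist c ` path_image g)"
    by (intro connected_continuous_image continuous_intros)
  moreover have "dist c (pathstart g) \<in> dist c ` path_image g" 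
    "dist c (pathfinish g) \<in> dist c ` path_image g" by auto
  ultimately have "r \<in> dist c ` path_image g"
    using g rR by (meson connected_contains_Icc atLeastAtMost_iff less_imp_le order_trans subsetD)
  then obtain u where u: "u \<in> {0..1}" "dist c (g u) = r" by (auto simp: path_image_def)
  let ?k = "subpath u 1 g"
  have k: "path ?k" "pathstart ?k = g u" "path_image ?k \<subseteq> path_image g"
    using u g path_image_subpath_subset[of u 1 g] by simp_all
  have fk: "pathfinish ?k = pathfinish g"
    by (simp add: pathfinish_def subpath_def)
  have "pathstart ?k \<in> closure (ball c R)" using u rR by (simp add: less_imp_le closure_subset[THEN subsetD])
  moreover have "pathfinish ?k \<notin> ball c R" using g fk by simp
  ultimately obtain h where h: "path h" "pathstart h = pathstart ?k" "path_image h \<subseteq> path_image ?k"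
    "path_image h - {pathfinish h} \<subseteq> interior (ball c R)" "pathfinish h \<in> frontier (ball c R)"
    using exists_path_subpath_to_frontier[OF k(1), of "ball c R"] by metis
  have fin: "pathfinish h \<in> sphere c R" using h(5) rR by (simp add: frontier_ball)
  show thesis
  proof
    show "path_image h \<subseteq> path_image g \<inter> cball c R"
    proof
      fix x assume x: "x \<in> path_image h"
      then have "x \<in> path_image g" using h(3) k(3) by blast
      moreover have "x \<in> cball c R"
      proof (cases "x = pathfinish h")
        case True then show ?thesis using fin by simp
      next
        case False
        then have "x \<in> ball c R" using x h(4) interior_subset by blast
        then show ?thesis by simp
      qed
      ultimately show "x \<in> path_image g \<inter> cball c R" by blast
    qed
  qed (use h k u fin in auto)
qed

section \<open>A measurable description of crossings\<close>

text \<open>One countable dense set is fixed once and for all, so that events formulated with it are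
  countable combinations of the values of the field.\<close>

definition dense_pts :: "(real^2) set" where
  "dense_pts = (SOME D. countable D \<and> (\<forall>X. open X \<longrightarrow> X \<noteq> {} \<longrightarrow> (\<exists>d\<in>D. d \<in> X)))"

lemma countable_dense_pts: "countable dense_pts"
  and dense_pts_meets: "open X \<Longrightarrow> X \<noteq> {} \<Longrightarrow> \<exists>d\<in>dense_pts. d \<in> X"
proof -
  have "\<exists>D::(real^2) set. countable D \<and> (\<forall>X. open X \<longrightarrow> X \<noteq> {} \<longrightarrow> (\<exists>d\<in>D. d \<in> X))"
    using countable_dense_exists by blast
  from someI_ex[OF this]
  show "countable dense_pts" "open X \<Longrightarrow> X \<noteq> {} \<Longrightarrow> \<exists>d\<in>dense_pts. d \<in> X"
    by (auto simp: dense_pts_def)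
qed

lemma dense_pts_near: 
  assumes "0 < r" obtains d where "d \<in> dense_pts" "dist x d < r"
  using dense_pts_meets[of "ball x r"] assms by auto

text \<open>The same \<open>r\<close> serves as radius and as margin below zero. The margin ensures
  that values at dense points give strict negativity on the whole ball when \<open>u\<close> is
  continuous.\<close>

definition below_near :: "real \<Rightarrow> (real^2 \<Rightarrow> real) \<Rightarrow> real^2 \<Rightarrow> bool" where
  "below_near r u a \<longleftrightarrow> (\<forall>d\<in>dense_pts. dist a d < r \<longrightarrow> u d \<le> - r)"

text \<open>A discrete path with \<open>n\<close> steps shorter than \<open>r\<close>; each step
  stays inside the ball on which its starting point controls \<open>u\<close>.\<close>

primrec chain :: "real \<Rightarrow> (real^2 \<Rightarrow> real) \<Rightarrow> nat \<Rightarrow> real^2 \<Rightarrow> real^2 \<Rightarrow> bool" where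
  "chain r u 0 a b \<longleftrightarrow> a = b \<and> below_near r u a"
| "chain r u (Suc n) a b \<longleftrightarrow>
     (\<exists>c\<in>dense_pts. chain r u n a c \<and> dist c b < r \<and> below_near r u b)"

text \<open>A version of the crossing event that is a countable combination of conditions on the values
  of \<open>u\<close> at the points of a countable dense set, and hence measurable in the product space.\<close>

definition arm :: "real \<Rightarrow> (real^2 \<Rightarrow> real) \<Rightarrow> bool" where
  "arm R u \<longleftrightarrow> (\<exists>k n. \<exists>a\<in>dense_pts. \<exists>b\<in>dense_pts. chain (1 / Suc k) u n a b \<and>
     (\<exists>p\<in>ball a (1 / Suc k). norm p \<le> 1) \<and> (\<exists>p\<in>ball b (1 / Suc k). R \<le> norm p))"

lemma below_near_antimono: "below_near r v a \<Longrightarrow> (\<And>x. u x \<le> v x) \<Longrightarrow> below_near r u a"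
  unfolding below_near_def using order_trans by blast

lemma chain_antimono: "chain r v n a b \<Longrightarrow> (\<And>x. u x \<le> v x) \<Longrightarrow> chain r u n a b"
proof (induction n arbitrary: b)
  case 0 then show ?case using below_near_antimono by auto
next
  case (Suc n) then show ?case using below_near_antimono by (metis chain.simps(2))
qed

lemma arm_antimono: "arm R v \<Longrightarrow> (\<And>x. u x \<le> v x) \<Longrightarrow> arm R u"
  unfolding arm_def using chain_antimono by meson

lemma measurable_chain:
  "Measurable.pred (Pi\<^sub>M UNIV (\<lambda>_. borel)) (\<lambda>u::real^2 \<Rightarrow> real. chain r u n a b)"
proof -
  have good: "Measurable.pred (Pi\<^sub>M UNIV (\<lambda>_. borel)) (\<lambda>u::real^2 \<Rightarrow> real. below_near r u a)" for a
    unfolding below_near_def 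
    by (intro measurable_pred_countable countable_dense_pts) measurable
  note [measurable] = good
  show ?thesis
  proof (induction n arbitrary: b)
    case 0 show ?case by simp
  next
    case (Suc n)
    note [measurable] = Suc
    show ?case unfolding chain.simps 
      by (intro measurable_pred_countable countable_dense_pts) measurable
  qed
qed

lemma measurable_arm [measurable]:
  "Measurable.pred (Pi\<^sub>M UNIV (\<lambda>_. borel)) (\<lambda>u::real^2 \<Rightarrow> real. arm R u)"
proof -
  note [measurable] = measurable_chain
  show ?thesis unfolding arm_def
    by (intro measurable_pred_countable countable_dense_pts pred_intros_countable) measurable
qed

text \<open>The set where \<open>u\<close> exceeds \<open>- r\<close> is open, so if it met the ball
  it would contain a dense point of the ball.\<close>

lemma below_near_ball:
  assumes "continuous_on UNIV u" "below_near r u a" "0 < r"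
  shows "ball a r \<subseteq> {x. u x < 0}"
proof -
  have op: "open {x. - r < u x}"
    using open_Collect_less[of "\<lambda>_. - r" u] assms by (simp add: continuous_on_const)
  have "u x \<le> - r" if x: "x \<in> ball a r" for x
  proof (rule ccontr)
    assume "\<not> u x \<le> - r"
    then have "x \<in> ball a r \<inter> {x. - r < u x}" using x by simp
    then obtain d where "d \<in> dense_pts" "d \<in> ball a r" "- r < u d"
      using dense_pts_meets[of "ball a r \<inter> {x. - r < u x}"] op by blast
    then show False using assms by (force simp: below_near_def)
  qed
  then show ?thesis using assms by fastforce
qed

lemma chain_path_component:
  assumes u: "continuous_on UNIV u" and r: "0 < r"
  shows "chain r u n a b \<Longrightarrow> path_component {x. u x < 0} a b \<and> below_near r u a \<and> below_near r u b"
proof (induction n arbitrary: b)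
  case 0
  then have "a \<in> {x. u x < 0}" using below_near_ball[OF u _ r, of a] r by (auto simp: subset_eq)
  then show ?case using 0 path_component_refl[of a "{x. u x < 0}"] by auto
next
  case (Suc n)
  then obtain c where c: "chain r u n a c" "dist c b < r" "below_near r u b" by auto
  with Suc have IH: "path_component {x. u x < 0} a c" "below_near r u a" "below_near r u c" by auto
  have "path_component (ball c r) c b"
    using c r convex_imp_path_connected[OF convex_ball, of c r] by (simp add: path_connected_component)
  then have "path_component {x. u x < 0} c b"
    using below_near_ball[OF u IH(3) r] path_component_of_subset by blast
  then show ?case using IH c path_component_trans by blast
qed

lemma arm_imp_path:
  assumes u: "continuous_on UNIV u" and arm: "arm R u" and R: "1 < R"
  obtains g where "path g" "path_image g \<subseteq> {x. u x < 0}"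
    "pathstart g \<in> sphere 0 1" "pathfinish g \<in> sphere 0 R"
proof -
  let ?U = "{x. u x < 0}"
  obtain k n a b p p' where *: "chain (1 / Suc k) u n a b"
     "p \<in> ball a (1 / Suc k)" "norm p \<le> 1" "p' \<in> ball b (1 / Suc k)" "R \<le> norm p'"
    using arm by (auto simp: arm_def)
  define r where "r = 1 / real (Suc k)"
  have r: "0 < r" by (simp add: r_def)
  note * = *[folded r_def]
  \<comment> \<open>The chain ends at \<open>a\<close> and \<open>b\<close>, whereas the norm bounds
    hold at nearby points \<open>p\<close> and \<open>p'\<close>; these are joined to it inside the
    controlled balls.\<close>
  have ball: "path_component ?U c q" if "q \<in> ball c r" "below_near r u c" for c q
  proof -
    have "path_component (ball c r) c q"
      using that r convex_imp_path_connected[OF convex_ball, of c r] by (simp add: path_connected_component)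
    then show ?thesis using below_near_ball[OF u that(2) r] path_component_of_subset by blast
  qed
  from chain_path_component[OF u r *(1)] *
  have "path_component ?U p p'" using ball path_component_trans path_component_sym by meson
  then obtain g where "path g" "path_image g \<subseteq> ?U" "pathstart g = p" "pathfinish g = p'"
    by (auto simp: path_component_def)
  note g = this
  obtain h where "path h" "path_image h \<subseteq> path_image g \<inter> cball 0 R"
    "pathstart h \<in> sphere 0 1" "pathfinish h \<in> sphere 0 R"
    by (rule path_crossing_annulus[of g 0 1 R]) (use g * R in simp_all)
  with g(2) show thesis by (intro that[of h]) blast+
qed

text \<open>Compactness of the path turns pointwise negativity into a uniform margin on a
  neighbourhood, within which the path can be replaced by a chain of dense points.\<close>

lemma path_imp_arm:
  assumes g: "path g" "norm (pathstart g) \<le> 1" "R \<le> norm (pathfinish g)"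
    and u: "continuous_on UNIV u" "\<And>x. x \<in> path_image g \<Longrightarrow> u x < 0"
  shows "arm R u"
proof -
  let ?C = "path_image g"
  have "closed {x. 0 \<le> u x}"
    using closed_Collect_le[of "\<lambda>_. 0" u] u by (simp add: continuous_on_const)
  moreover have "?C \<inter> {x. 0 \<le> u x} = {}" using u by fastforce
  ultimately obtain e where e: "e > 0" "\<And>x y. x \<in> ?C \<Longrightarrow> 0 \<le> u y \<Longrightarrow> e \<le> dist x y"
    using separate_compact_closed[of ?C "{x. 0 \<le> u x}"] compact_path_image[OF g(1)] by (metis mem_Collect_eq)
  \<comment> \<open>The closed \<open>e/2\<close>-neighbourhood of the path is compact and avoids
    \<open>{x. 0 \<le> u x}\<close>, so \<open>u\<close> has a negative maximum on it.\<close>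
  define T where "T = {x + y |x y. x \<in> ?C \<and> y \<in> cball (0::real^2) (e/2)}"
  have "compact T" unfolding T_def using g by (intro compact_sums compact_path_image compact_cball)
  moreover have "T \<noteq> {}" 
  proof -
    have "pathstart g + 0 \<in> T" unfolding T_def
      by (intro CollectI exI conjI, rule refl) (use e in auto)
    then show ?thesis by blast
  qed
  ultimately obtain m where m: "m \<in> T" "\<And>x. x \<in> T \<Longrightarrow> u x \<le> u m"
    using continuous_attains_sup[of T u] u continuous_on_subset by blast
  have "u m < 0"
  proof (rule ccontr)
    assume "\<not> u m < 0"
    moreover obtain x y where "m = x + y" "x \<in> ?C" "norm y \<le> e/2" using m by (auto simp: T_def)
    ultimately show False using e(2)[of x m] e(1) by (simp add: dist_norm)
  qed
  \<comment> \<open>With \<open>r < e/4\<close>, a ball of radius \<open>r\<close> about a point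
    closer than \<open>r\<close> to the path stays in \<open>T\<close>; with
    \<open>r < - u m\<close>, the margin holds there.\<close>
  then have "0 < min (e/4) (- u m)" using e by simp
  then obtain k where k: "1 / Suc k < min (e/4) (- u m)"
    using nat_approx_posE by metis
  define r where "r = 1 / real (Suc k)"
  have r: "0 < r" "2 * r < e/2" "r < - u m" using k by (auto simp: r_def)
  have good: "below_near r u a" if "x \<in> ?C" "dist x a < r" for x a
    unfolding below_near_def
  proof (intro ballI impI)
    fix d assume "dist a d < r"
    then have "dist x d < 2 * r" using that dist_triangle[of x d a] by simp
    then have "d = x + (d - x)" "norm (d - x) \<le> e / 2" using r by (auto simp: dist_norm norm_minus_commute)
    then have "d \<in> T" using that unfolding T_def by fastforce
    then show "u d \<le> - r" using m(2)[of d] r by simp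
  qed
  \<comment> \<open>Consecutive dense points must be closer than \<open>r\<close>: one third for the
    increment of \<open>g\<close>, and one third for each of the two approximations.\<close>
  have "uniformly_continuous_on {0..1} g"
    using g by (intro compact_uniformly_continuous) (auto simp: path_def)
  then obtain \<delta> where \<delta>: "\<delta> > 0" "\<And>s t. s \<in> {0..1} \<Longrightarrow> t \<in> {0..1} \<Longrightarrow> dist s t < \<delta> \<Longrightarrow> dist (g s) (g t) < r/3"
    using r unfolding uniformly_continuous_on_def by (auto elim!: allE[of _ "r/3"] simp: dist_commute)
  obtain N where N: "1 / Suc N < \<delta>" using \<delta> nat_approx_posE by metis
  define t where "t j = real j / Suc N" for j
  have "\<exists>d\<in>dense_pts. dist (g (t j)) d < r/3" for j
    using dense_pts_near[of "r/3" "g (t j)"] r by auto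
  then obtain d where d: "\<And>j. d j \<in> dense_pts" "\<And>j. dist (g (t j)) (d j) < r/3" by metis
  have gd: "below_near r u (d j)" if "j \<le> Suc N" for j
  proof (rule good)
    show "g (t j) \<in> ?C" using that by (auto simp: path_image_def t_def intro!: imageI)
    show "dist (g (t j)) (d j) < r" using d(2)[of j] r by simp
  qed
  have ch: "chain r u j (d 0) (d j)" if "j \<le> Suc N" for j
    using that
  proof (induction j)
    case 0 then show ?case using gd by simp
  next
    case (Suc j)
    have "t j \<in> {0..1}" "t (Suc j) \<in> {0..1}" using Suc by (auto simp: t_def)
    moreover have "dist (t j) (t (Suc j)) < \<delta>" using N by (simp add: t_def dist_real_def flip: diff_divide_distrib)
    ultimately have "dist (g (t j)) (g (t (Suc j))) < r/3" by (rule \<delta>(2))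
    then have "dist (d j) (d (Suc j)) < r"
      using d(2)[of j] d(2)[of "Suc j"] dist_triangle[of "d j" "d (Suc j)" "g (t j)"]
        dist_triangle[of "g (t j)" "d (Suc j)" "g (t (Suc j))"]
      by (simp add: dist_commute)
    then show ?case using Suc gd d by auto
  qed
  have "g (t 0) \<in> ball (d 0) r" "g (t (Suc N)) \<in> ball (d (Suc N)) r"
    using d(2)[of 0] d(2)[of "Suc N"] r by (simp_all add: dist_commute)
  moreover have "g (t 0) = pathstart g" "g (t (Suc N)) = pathfinish g"
    by (auto simp: t_def pathstart_def pathfinish_def simp del: of_nat_Suc)
  ultimately have "\<exists>p\<in>ball (d 0) r. norm p \<le> 1" "\<exists>p\<in>ball (d (Suc N)) r. R \<le> norm p"
    using g by metis+
  then have "chain r u (Suc N) (d 0) (d (Suc N)) \<and> (\<exists>p\<in>ball (d 0) r. norm p \<le> 1) \<and>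
      (\<exists>p\<in>ball (d (Suc N)) r. R \<le> norm p)"
    using ch[of "Suc N"] by blast
  then show ?thesis
    unfolding arm_def r_def using d(1) by blast
qed

section \<open>Characteristic functions determine the law of a process\<close>

lemma measurable_cis [measurable]: "cis \<in> borel_measurable borel"
  by (intro borel_measurable_continuous_onI continuous_intros)

lemma integral_lincomb3:
  fixes F G H :: "'a \<Rightarrow> complex"
  assumes "integrable M F" "integrable M G" "integrable M H"
  shows "(LINT w|M. a * F w + b * G w + c * H w) = a * integral\<^sup>L M F + b * integral\<^sup>L M G + c * integral\<^sup>L M H"
  using assms by simp

text \<open>Normalised by their common total mass, which is the case \<open>t = 0\<close> of the
  hypothesis, the weights become probability densities, and Levy's uniqueness theorem applies under
  the new measures.\<close>

lemma weighted_Levy_uniqueness: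
  fixes X W :: "'a \<Rightarrow> real" and Y V :: "'b \<Rightarrow> real"
  assumes M: "prob_space M" and N: "prob_space N"
    and meas [measurable]: "X \<in> borel_measurable M" "W \<in> borel_measurable M"
      "Y \<in> borel_measurable N" "V \<in> borel_measurable N"
    and W: "\<And>w. 0 \<le> W w" "\<And>w. W w \<le> B" and V: "\<And>w. 0 \<le> V w" "\<And>w. V w \<le> B"
    and eq: "\<And>t. (CLINT w|M. W w * cis (t * X w)) = (CLINT w|N. V w * cis (t * Y w))"
    and A [measurable]: "A \<in> sets borel"
  shows "(LINT w|M. W w * indicator A (X w)) = (LINT w|N. V w * indicator A (Y w))"
proof -
  interpret M: prob_space M by fact
  interpret N: prob_space N by fact
  have intW [simp]: "integrable M W" by (rule M.integrable_const_bound[of _ B]) (use W in auto)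
  have intV [simp]: "integrable N V" by (rule N.integrable_const_bound[of _ B]) (use V in auto)
  define m where "m = (LINT w|M. W w)"
  have m: "m = (LINT w|N. V w)"
    using eq[of 0] by (simp add: m_def)
  show ?thesis
  proof (cases "m = 0")
    \<comment> \<open>Weights of mass zero cannot be normalised, but they vanish almost
      everywhere.\<close>
    case True
    have "AE w in M. W w = 0" using True W integral_nonneg_eq_0_iff_AE[OF intW] by (simp add: m_def)
    moreover have "AE w in N. V w = 0" using True V integral_nonneg_eq_0_iff_AE[OF intV] by (simp add: m)
    ultimately have "(LINT w|M. W w * indicator A (X w)) = (LINT w|M. 0)"
      "(LINT w|N. V w * indicator A (Y w)) = (LINT w|N. 0)"
      by (auto intro!: integral_eq_zero_AE)
    then show ?thesis by simp
  next
    case False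
    then have mpos: "m > 0" using W by (simp add: m_def less_le integral_nonneg_AE)
    define M' where "M' = density M (\<lambda>w. ennreal (W w / m))"
    define N' where "N' = density N (\<lambda>w. ennreal (V w / m))"
    have M': "prob_space M'"
    proof
      have "emeasure M' (space M') = (\<integral>\<^sup>+w. ennreal (W w / m) \<partial>M)"
        by (simp add: M'_def emeasure_density cong: nn_integral_cong)
      also have "\<dots> = ennreal (LINT w|M. W w / m)"
        using W mpos by (intro nn_integral_eq_integral) auto
      finally show "emeasure M' (space M') = 1" using mpos by (simp add: m_def)
    qed
    have N': "prob_space N'"
    proof
      have "emeasure N' (space N') = (\<integral>\<^sup>+w. ennreal (V w / m) \<partial>N)"
        by (simp add: N'_def emeasure_density cong: nn_integral_cong)
      also have "\<dots> = ennreal (LINT w|N. V w / m)"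
        using V mpos by (intro nn_integral_eq_integral) auto
      finally show "emeasure N' (space N') = 1" using mpos by (simp add: m)
    qed
    interpret M': prob_space M' by fact
    interpret N': prob_space N' by fact
    have meas' [measurable]: "X \<in> borel_measurable M'" "Y \<in> borel_measurable N'"
      by (simp_all add: M'_def N'_def)
    have "char (distr M' borel X) = char (distr N' borel Y)"
    proof
      fix t
      have "char (distr M' borel X) t = (CLINT w|M'. cis (t * X w))"
        by (simp add: char_def integral_distr cis_conv_exp)
      also have "\<dots> = (CLINT w|M. (W w * cis (t * X w)) / m)"
        using W mpos unfolding M'_def by (subst integral_density) (auto simp: scaleR_conv_of_real)
      also have "\<dots> = (CLINT w|N. (V w * cis (t * Y w)) / m)"
        using eq[of t] by simp
      also have "\<dots> = (CLINT w|N'. cis (t * Y w))"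
        using V mpos unfolding N'_def by (subst integral_density) (auto simp: scaleR_conv_of_real)
      also have "\<dots> = char (distr N' borel Y) t"
        by (simp add: char_def integral_distr cis_conv_exp)
      finally show "char (distr M' borel X) t = char (distr N' borel Y) t" .
    qed
    then have distr: "distr M' borel X = distr N' borel Y"
      by (intro Levy_uniqueness) auto
    have "(LINT w|M. W w * indicator A (X w)) / m = (LINT w|M'. indicator A (X w))"
      using W mpos unfolding M'_def by (subst integral_density) (auto simp: ac_simps)
    also have "\<dots> = (LINT x|distr M' borel X. indicator A x)"
      by (subst integral_distr) auto
    also have "\<dots> = (LINT w|N'. indicator A (Y w))"
      unfolding distr by (subst integral_distr) auto
    also have "\<dots> = (LINT w|N. V w * indicator A (Y w)) / m"
      using V mpos unfolding N'_def by (subst integral_density) (auto simp: ac_simps)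
    finally show ?thesis using mpos by simp
  qed
qed

text \<open>The index \<open>j\<close> may already belong to \<open>S\<close>, in which case the two
  coefficients add up.\<close>

lemma lincomb_insert:
  fixes c x :: "'i \<Rightarrow> 'a::ring"
  assumes "finite S"
  shows "(\<Sum>i\<in>S. c i * x i) + t * x j
    = (\<Sum>i\<in>insert j S. ((if i \<in> S then c i else 0) + (if i = j then t else 0)) * x i)"
proof -
  have "(\<Sum>i\<in>S. c i * x i) = (\<Sum>i\<in>insert j S. (if i \<in> S then c i else 0) * x i)"
    using assms by (intro sum.mono_neutral_cong_left) auto
  moreover have "t * x j = (\<Sum>i\<in>insert j S. (if i = j then t else 0) * x i)"
    using assms by (subst sum.mono_neutral_cong_right[of _ "{j}" _ "\<lambda>i. t * x i"]) auto
  ultimately show ?thesis by (simp add: sum.distrib distrib_right)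
qed

text \<open>Euler's formula for the cosine, arranged so that each summand has the form
  \<open>p * cis (s * a + b)\<close> with \<open>s\<close> equal to 0, 1 or -1.\<close>

lemma cis_mult_cos:
  "complex_of_real (p * (2 + cos (a + c))) * cis b = 2 * (p * cis (0 * a + b))
    + (cis c / 2) * (p * cis (1 * a + b)) + (cis (- c) / 2) * (p * cis ((- 1) * a + b))"
  by (simp add: complex_eq_iff cos_add sin_add cos_diff sin_diff field_simps)

text \<open>The induction adds one indicator at a time. The indicators already present, combined
  with a trigonometric factor of the linear combination, form a weight, and the weighted uniqueness
  theorem is applied to the new coordinate.\<close>

lemma cf_indicator_eq:
  fixes X :: "'i \<Rightarrow> 'a \<Rightarrow> real" and Y :: "'i \<Rightarrow> 'b \<Rightarrow> real"
  assumes M: "prob_space M" and N: "prob_space N"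
    and meas [measurable]: "\<And>i. X i \<in> borel_measurable M" "\<And>i. Y i \<in> borel_measurable N"
    and cf: "\<And>S c. finite S \<Longrightarrow>
      (CLINT w|M. cis (\<Sum>i\<in>S. c i * X i w)) = (CLINT w|N. cis (\<Sum>i\<in>S. c i * Y i w))"
    and A [measurable]: "\<And>i. A i \<in> sets borel" and J: "finite J" and S: "finite S"
  shows "(CLINT w|M. complex_of_real (\<Prod>j\<in>J. indicator (A j) (X j w)) * cis (\<Sum>i\<in>S. c i * X i w))
       = (CLINT w|N. complex_of_real (\<Prod>j\<in>J. indicator (A j) (Y j w)) * cis (\<Sum>i\<in>S. c i * Y i w))"
  using J S
proof (induction J arbitrary: S c)
  case empty
  then show ?case using cf by simp
next
  case (insert j J)
  interpret M: prob_space M by fact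
  interpret N: prob_space N by fact
  define P where "P w = (\<Prod>j\<in>J. indicator (A j) (X j w) :: real)" for w
  define Q where "Q w = (\<Prod>j\<in>J. indicator (A j) (Y j w) :: real)" for w
  define U where "U w = (\<Sum>i\<in>S. c i * X i w)" for w
  define V where "V w = (\<Sum>i\<in>S. c i * Y i w)" for w
  have [measurable]: "P \<in> borel_measurable M" "Q \<in> borel_measurable N"
      "U \<in> borel_measurable M" "V \<in> borel_measurable N"
    unfolding P_def Q_def U_def V_def by measurable
  have P: "0 \<le> P w" "P w \<le> 1" for w
    by (auto simp: P_def intro!: prod_nonneg prod_le_1)
  have Q: "0 \<le> Q w" "Q w \<le> 1" for w
    by (auto simp: Q_def intro!: prod_nonneg prod_le_1)
  have iM: "integrable M F" if [measurable]: "F \<in> borel_measurable M" and "\<And>w. norm (F w) \<le> 3" 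
    for F :: "'a \<Rightarrow> 'c::{banach,second_countable_topology}"
    using that by (intro M.integrable_const_bound[of _ 3]) auto
  have iN: "integrable N F" if [measurable]: "F \<in> borel_measurable N" and "\<And>w. norm (F w) \<le> 3" 
    for F :: "'b \<Rightarrow> 'c::{banach,second_countable_topology}"
    using that by (intro N.integrable_const_bound[of _ 3]) auto
  have bM: "norm (P w * indicator (A j) (X j w)) \<le> 3" 
      "norm (P w * cos x * indicator (A j) (X j w)) \<le> 3"
      "norm (complex_of_real (P w * indicator (A j) (X j w)) * cis x) \<le> 3" for w x
    using P[of w] mult_le_one[of "P w" "\<bar>cos x\<bar>"] by (auto simp: indicator_def norm_mult abs_mult)
  have bN: "norm (Q w * indicator (A j) (Y j w)) \<le> 3" 
      "norm (Q w * cos x * indicator (A j) (Y j w)) \<le> 3"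
      "norm (complex_of_real (Q w * indicator (A j) (Y j w)) * cis x) \<le> 3" for w x
    using Q[of w] mult_le_one[of "Q w" "\<bar>cos x\<bar>"] by (auto simp: indicator_def norm_mult abs_mult)
  \<comment> \<open>The induction hypothesis holds for all coefficients, so the term
    \<open>t * X j w\<close> is absorbed into the linear combination.\<close>
  have base: "(CLINT w|M. P w * cis (s * U w + t * X j w)) = (CLINT w|N. Q w * cis (s * V w + t * Y j w))"
    for s t
  proof -
    have 1: "s * U w + t * X j w = (\<Sum>i\<in>insert j S. ((if i \<in> S then s * c i else 0) + (if i = j then t else 0)) * X i w)" for w
      unfolding U_def sum_distrib_left using lincomb_insert[OF insert.prems, of "\<lambda>i. s * c i" "\<lambda>i. X i w" t j]
      by (simp add: ac_simps)
    have 2: "s * V w + t * Y j w = (\<Sum>i\<in>insert j S. ((if i \<in> S then s * c i else 0) + (if i = j then t else 0)) * Y i w)" for w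
      unfolding V_def sum_distrib_left using lincomb_insert[OF insert.prems, of "\<lambda>i. s * c i" "\<lambda>i. Y i w" t j]
      by (simp add: ac_simps)
    show ?thesis unfolding 1 2 P_def Q_def using insert.prems by (intro insert.IH) auto
  qed
  have ind: "(LINT w|M. P w * indicator (A j) (X j w)) = (LINT w|N. Q w * indicator (A j) (Y j w))"
    using base[of 0] P Q by (intro weighted_Levy_uniqueness[of M N _ _ _ _ 1] M N) auto
  \<comment> \<open>A weight must be nonnegative, so the cosine is raised by 2; the contribution of
    the constant is then removed by \<open>ind\<close>.\<close>
  have step: "(LINT w|M. P w * cos (U w + th) * indicator (A j) (X j w))
            = (LINT w|N. Q w * cos (V w + th) * indicator (A j) (Y j w))" for th
  proof -
    have "(LINT w|M. P w * (2 + cos (U w + th)) * indicator (A j) (X j w))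
       = (LINT w|N. Q w * (2 + cos (V w + th)) * indicator (A j) (Y j w))"
    proof (rule weighted_Levy_uniqueness[of M N _ _ _ _ 3])
      fix t
      have "(CLINT w|M. complex_of_real (P w * (2 + cos (U w + th))) * cis (t * X j w))
          = (CLINT w|M. 2 * (P w * cis (0 * U w + t * X j w))
                + (cis th / 2) * (P w * cis (1 * U w + t * X j w)) 
                + (cis (- th) / 2) * (P w * cis ((-1) * U w + t * X j w)))"
        by (simp only: cis_mult_cos)
      also have "\<dots> = 2 * (CLINT w|M. (P w * cis (0 * U w + t * X j w)))
                + (cis th / 2) * (CLINT w|M. (P w * cis (1 * U w + t * X j w)))
                + (cis (- th) / 2) * (CLINT w|M. (P w * cis ((-1) * U w + t * X j w)))"
        using P(1) P(2)[THEN order_trans, of 3]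
        by (intro integral_lincomb3 iM) (simp_all add: norm_mult)
      also have "\<dots> = 2 * (CLINT w|N. (Q w * cis (0 * V w + t * Y j w)))
                + (cis th / 2) * (CLINT w|N. (Q w * cis (1 * V w + t * Y j w)))
                + (cis (- th) / 2) * (CLINT w|N. (Q w * cis ((-1) * V w + t * Y j w)))"
        by (simp only: base)
      also have "\<dots> = (CLINT w|N. 2 * (Q w * cis (0 * V w + t * Y j w))
                + (cis th / 2) * (Q w * cis (1 * V w + t * Y j w)) 
                + (cis (- th) / 2) * (Q w * cis ((-1) * V w + t * Y j w)))"
        using Q(1) Q(2)[THEN order_trans, of 3]
        by (intro integral_lincomb3[symmetric] iN) (simp_all add: norm_mult)
      also have "\<dots> = (CLINT w|N. complex_of_real (Q w * (2 + cos (V w + th))) * cis (t * Y j w))"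
        by (simp only: cis_mult_cos)
      finally show "(CLINT w|M. complex_of_real (P w * (2 + cos (U w + th))) * cis (t * X j w))
         = (CLINT w|N. complex_of_real (Q w * (2 + cos (V w + th))) * cis (t * Y j w))" .
    next
      have c: "0 \<le> 2 + cos x" "2 + cos x \<le> 3" for x :: real
        using cos_ge_minus_one[of x] cos_le_one[of x] by linarith+
      show "0 \<le> P w * (2 + cos (U w + th))" "P w * (2 + cos (U w + th)) \<le> 3" for w
        using P[of w] c[of "U w + th"] mult_mono[of "P w" 1 "2 + cos (U w + th)" 3] by auto
      show "0 \<le> Q w * (2 + cos (V w + th))" "Q w * (2 + cos (V w + th)) \<le> 3" for w
        using Q[of w] c[of "V w + th"] mult_mono[of "Q w" 1 "2 + cos (V w + th)" 3] by auto
    qed (use M N in auto)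
    moreover have "(LINT w|M. P w * (2 + cos (U w + th)) * indicator (A j) (X j w))
       = 2 * (LINT w|M. P w * indicator (A j) (X j w)) + (LINT w|M. P w * cos (U w + th) * indicator (A j) (X j w))"
    proof -
      have "integrable M (\<lambda>w. P w * indicator (A j) (X j w))"
        by (rule iM[OF _ bM(1)]) measurable
      moreover have "integrable M (\<lambda>w. P w * cos (U w + th) * indicator (A j) (X j w))"
        by (rule iM[OF _ bM(2)]) measurable
      ultimately have "(LINT w|M. 2 * (P w * indicator (A j) (X j w))
          + P w * cos (U w + th) * indicator (A j) (X j w))
        = 2 * (LINT w|M. P w * indicator (A j) (X j w))
          + (LINT w|M. P w * cos (U w + th) * indicator (A j) (X j w))"
        by simp
      then show ?thesis by (simp add: algebra_simps)
    qed
    moreover have "(LINT w|N. Q w * (2 + cos (V w + th)) * indicator (A j) (Y j w))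
       = 2 * (LINT w|N. Q w * indicator (A j) (Y j w)) + (LINT w|N. Q w * cos (V w + th) * indicator (A j) (Y j w))"
    proof -
      have "integrable N (\<lambda>w. Q w * indicator (A j) (Y j w))"
        by (rule iN[OF _ bN(1)]) measurable
      moreover have "integrable N (\<lambda>w. Q w * cos (V w + th) * indicator (A j) (Y j w))"
        by (rule iN[OF _ bN(2)]) measurable
      ultimately have "(LINT w|N. 2 * (Q w * indicator (A j) (Y j w))
          + Q w * cos (V w + th) * indicator (A j) (Y j w))
        = 2 * (LINT w|N. Q w * indicator (A j) (Y j w))
          + (LINT w|N. Q w * cos (V w + th) * indicator (A j) (Y j w))"
        by simp
      then show ?thesis by (simp add: algebra_simps)
    qed
    ultimately show ?thesis using ind by simp
  qed
  have PM: "complex_of_real (\<Prod>j\<in>insert j J. indicator (A j) (X j w)) * cis (\<Sum>i\<in>S. c i * X i w)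
    = complex_of_real (P w * indicator (A j) (X j w)) * cis (U w)" for w
    using insert.hyps by (simp add: P_def U_def ac_simps)
  have QN: "complex_of_real (\<Prod>j\<in>insert j J. indicator (A j) (Y j w)) * cis (\<Sum>i\<in>S. c i * Y i w)
    = complex_of_real (Q w * indicator (A j) (Y j w)) * cis (V w)" for w
    using insert.hyps by (simp add: Q_def V_def ac_simps)
  have "integrable M (\<lambda>w. complex_of_real (P w * indicator (A j) (X j w)) * cis (U w))"
    by (rule iM[OF _ bM(3)]) measurable
  moreover have "integrable N (\<lambda>w. complex_of_real (Q w * indicator (A j) (Y j w)) * cis (V w))"
    by (rule iN[OF _ bN(3)]) measurable
  \<comment> \<open>The phase 0 yields the real part, and the phase \<open>- pi / 2\<close>, which
    turns cosine into sine, the imaginary part.\<close>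
  ultimately show ?case unfolding PM QN using step[of 0] step[of "- pi / 2"]
    by (intro complex_eqI) (simp_all add: cos_diff ac_simps flip: integral_Re integral_Im)
qed

text \<open>Measures on the product space are determined by finite-dimensional cylinders, whose
  probabilities are the indicator integrals above with the empty linear combination.\<close>

lemma process_law_unique:
  fixes X :: "'i \<Rightarrow> 'a \<Rightarrow> real" and Y :: "'i \<Rightarrow> 'b \<Rightarrow> real"
  assumes M: "prob_space M" and N: "prob_space N"
    and meas [measurable]: "\<And>i. X i \<in> borel_measurable M" "\<And>i. Y i \<in> borel_measurable N"
    and cf: "\<And>S c. finite S \<Longrightarrow>
      (CLINT w|M. cis (\<Sum>i\<in>S. c i * X i w)) = (CLINT w|N. cis (\<Sum>i\<in>S. c i * Y i w))"
  shows "distr M (Pi\<^sub>M UNIV (\<lambda>_. borel)) (\<lambda>w i. X i w) = distr N (Pi\<^sub>M UNIV (\<lambda>_. borel)) (\<lambda>w i. Y i w)"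
proof -
  interpret M: prob_space M by fact
  interpret N: prob_space N by fact
  have mX [measurable]: "(\<lambda>w i. X i w) \<in> measurable M (Pi\<^sub>M UNIV (\<lambda>_. borel))"
    and mY [measurable]: "(\<lambda>w i. Y i w) \<in> measurable N (Pi\<^sub>M UNIV (\<lambda>_. borel))"
    by (rule measurable_PiM_single'; simp)+
  show ?thesis
  proof (rule measure_eqI_PiM_infinite[where I=UNIV and M="\<lambda>_. borel"])
    fix A :: "'i \<Rightarrow> real set" and J :: "'i set"
    assume J: "finite J" and A': "\<And>i. i \<in> J \<Longrightarrow> A i \<in> sets borel"
    define B where "B i = (if i \<in> J then A i else UNIV)" for i
    have B [measurable]: "B i \<in> sets borel" for i using A' by (auto simp: B_def)
    let ?E = "prod_emb UNIV (\<lambda>_. borel) J (Pi\<^sub>E J A) :: ('i \<Rightarrow> real) set"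
    have E: "?E = {u. \<forall>j\<in>J. u j \<in> B j}"
      by (auto simp: prod_emb_def B_def PiE_iff)
    have Em: "?E \<in> sets (Pi\<^sub>M UNIV (\<lambda>_. borel))"
      using J A' by (intro sets_PiM_I) auto
    have iX: "indicator ((\<lambda>w i. X i w) -` ?E) w = (\<Prod>j\<in>J. indicator (B j) (X j w) :: real)" for w
      using J unfolding E by (auto simp: indicator_def prod_zero_iff intro!: prod.neutral[symmetric])
    have iY: "indicator ((\<lambda>w i. Y i w) -` ?E) w = (\<Prod>j\<in>J. indicator (B j) (Y j w) :: real)" for w
      using J unfolding E by (auto simp: indicator_def prod_zero_iff intro!: prod.neutral[symmetric])
    have "(CLINT w|M. complex_of_real (\<Prod>j\<in>J. indicator (B j) (X j w)) * cis (\<Sum>i\<in>{}. 0 * X i w))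
       = (CLINT w|N. complex_of_real (\<Prod>j\<in>J. indicator (B j) (Y j w)) * cis (\<Sum>i\<in>{}. 0 * Y i w))"
      by (rule cf_indicator_eq[OF M N meas cf B J]) auto
    then have "(LINT w|M. indicator ((\<lambda>w i. X i w) -` ?E) w) = (LINT w|N. indicator ((\<lambda>w i. Y i w) -` ?E) w :: real)"
      unfolding iX iY by (simp del: of_real_prod)
    then have "measure M ((\<lambda>w i. X i w) -` ?E \<inter> space M) = measure N ((\<lambda>w i. Y i w) -` ?E \<inter> space N)"
      by simp
    then show "emeasure (distr M (Pi\<^sub>M UNIV (\<lambda>_. borel)) (\<lambda>w i. X i w)) ?E
        = emeasure (distr N (Pi\<^sub>M UNIV (\<lambda>_. borel)) (\<lambda>w i. Y i w)) ?E"
      using Em by (simp add: emeasure_distr M.emeasure_eq_measure N.emeasure_eq_measure)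
  next
    show "finite_measure (distr M (Pi\<^sub>M UNIV (\<lambda>_. borel)) (\<lambda>w i. X i w))"
      by (rule M.finite_measure_distr) simp
  qed simp_all
qed

section \<open>Gaussian processes\<close>

lemma (in prob_space) gaussian_rv_square_integrable:
  assumes "gaussian_rv M X"
  shows "integrable M (\<lambda>w. (X w)\<^sup>2)"
proof -
  have [measurable]: "X \<in> borel_measurable M" using assms by (simp add: gaussian_rv_def)
  from assms obtain \<mu> where "(AE w in M. X w = \<mu>) \<or> (\<exists>\<sigma>>0. distributed M lborel X (normal_density \<mu> \<sigma>))"
    by (auto simp: gaussian_rv_def)
  then show ?thesis
  proof (elim disjE exE conjE)
    assume "AE w in M. X w = \<mu>"
    then have "integrable M (\<lambda>w. (X w)\<^sup>2) \<longleftrightarrow> integrable M (\<lambda>w. \<mu>\<^sup>2)"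
      by (intro integrable_cong_AE) auto
    then show ?thesis by simp
  next
    fix \<sigma> :: real assume \<sigma>: "0 < \<sigma>" and D: "distributed M lborel X (normal_density \<mu> \<sigma>)"
    \<comment> \<open>The second moment is expanded in the centered second moment, the first moment
      and the total mass.\<close>
    have "integrable lborel (\<lambda>x. normal_density \<mu> \<sigma> x * (x - \<mu>)^2 + 2 * \<mu> * (normal_density \<mu> \<sigma> x * x)
        - \<mu>\<^sup>2 * normal_density \<mu> \<sigma> x)"
      using \<sigma> integrable_normal_moment[OF \<sigma>, of \<mu> 2] integrable_normal_moment_nz_1[OF \<sigma>, of \<mu>] by simp
    moreover have "(\<lambda>x. normal_density \<mu> \<sigma> x * (x - \<mu>)^2 + 2 * \<mu> * (normal_density \<mu> \<sigma> x * x)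
        - \<mu>\<^sup>2 * normal_density \<mu> \<sigma> x) = (\<lambda>x. normal_density \<mu> \<sigma> x * x\<^sup>2)"
      by (simp add: fun_eq_iff power2_eq_square algebra_simps)
    ultimately show ?thesis
      using distributed_integrable[OF D, of "\<lambda>x. x\<^sup>2"] by simp
  qed
qed

text \<open>A degenerate variable of mean zero vanishes almost surely. Otherwise
  \<open>X / \<sigma>\<close> is standard normal, and its characteristic function is evaluated at
  \<open>\<sigma>\<close>.\<close>

lemma (in prob_space) gaussian_rv_cf:
  assumes X: "gaussian_rv M X" and mean: "expectation X = 0"
  shows "(CLINT w|M. cis (X w)) = exp (- expectation (\<lambda>w. (X w)\<^sup>2) / 2)"
proof -
  have [measurable]: "X \<in> borel_measurable M" using X by (simp add: gaussian_rv_def)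
  from X obtain \<mu> where "(AE w in M. X w = \<mu>) \<or> (\<exists>\<sigma>>0. distributed M lborel X (normal_density \<mu> \<sigma>))"
    by (auto simp: gaussian_rv_def)
  then show ?thesis
  proof (elim disjE exE conjE)
    assume ae: "AE w in M. X w = \<mu>"
    then have "expectation X = expectation (\<lambda>_. \<mu>)" by (intro integral_cong_AE) auto
    then have "\<mu> = 0" using mean by (simp add: prob_space)
    with ae have "(CLINT w|M. cis (X w)) = (CLINT w|M. 1)" "expectation (\<lambda>w. (X w)\<^sup>2) = expectation (\<lambda>w. 0)"
      by (intro integral_cong_AE; auto)+
    then show ?thesis by (simp add: prob_space)
  next
    fix \<sigma> :: real assume \<sigma>: "0 < \<sigma>" and D: "distributed M lborel X (normal_density \<mu> \<sigma>)"
    have "\<mu> = 0" using normal_distributed_expectation[OF \<sigma> D] mean by simp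
    have var: "expectation (\<lambda>w. (X w)\<^sup>2) = \<sigma>\<^sup>2"
      using normal_distributed_variance[OF \<sigma> D] mean by simp
    have "distributed M lborel (\<lambda>w. X w / \<sigma>) std_normal_density"
      using D normal_standard_normal_convert[OF \<sigma>, of X 0] \<open>\<mu> = 0\<close> by simp
    then have dd: "distr M lborel (\<lambda>w. X w / \<sigma>) = density lborel std_normal_density"
      by (rule distributed_distr_eq_density)
    have "(CLINT w|M. cis (X w)) = (CLINT x|distr M lborel (\<lambda>w. X w / \<sigma>). cis (\<sigma> * x))"
      using \<sigma> by (subst integral_distr) auto
    also have "\<dots> = char std_normal_distribution \<sigma>"
      unfolding dd by (simp add: char_def cis_conv_exp)
    also have "\<dots> = exp (- \<sigma>\<^sup>2 / 2)"
      by (simp add: char_std_normal_distribution)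
    finally show ?thesis by (simp add: var flip: exp_of_real)
  qed
qed

section \<open>Centered Gaussian processes through characteristic functions\<close>

text \<open>The covariance of two linear combinations of a centered process with covariance
  \<open>K\<close>.\<close>

definition quad_form :: "('i \<Rightarrow> 'i \<Rightarrow> real) \<Rightarrow> 'i set \<Rightarrow> ('i \<Rightarrow> real) \<Rightarrow> ('i \<Rightarrow> real) \<Rightarrow> real" where
  "quad_form K S c d = (\<Sum>i\<in>S. \<Sum>j\<in>S. c i * d j * K i j)"

text \<open>Expresses that \<open>X\<close> is a centered Gaussian process with covariance
  \<open>K\<close>. This form treats degenerate combinations like all others and determines the law
  directly.\<close>

definition gaussian_cf :: "'w measure \<Rightarrow> ('i \<Rightarrow> 'w \<Rightarrow> real) \<Rightarrow> ('i \<Rightarrow> 'i \<Rightarrow> real) \<Rightarrow> bool" where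
  "gaussian_cf M X K \<longleftrightarrow> (\<forall>i. X i \<in> borel_measurable M) \<and>
     (\<forall>S c. finite S \<longrightarrow>
       (CLINT w|M. cis (\<Sum>i\<in>S. c i * X i w)) = exp (- quad_form K S c c / 2))"

lemma gaussian_cf_law_unique:
  assumes "prob_space M" "prob_space N" "gaussian_cf M X K" "gaussian_cf N Y K"
  shows "distr M (Pi\<^sub>M UNIV (\<lambda>_. borel)) (\<lambda>w i. X i w) = distr N (Pi\<^sub>M UNIV (\<lambda>_. borel)) (\<lambda>w i. Y i w)"
  using assms by (intro process_law_unique) (auto simp: gaussian_cf_def)

lemma gaussian_cf_reindex:
  fixes T :: "'j \<Rightarrow> 'i"
  assumes "gaussian_cf M X K" and T: "inj T"
  shows "gaussian_cf M (\<lambda>i. X (T i)) (\<lambda>i j. K (T i) (T j))"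
  unfolding gaussian_cf_def
proof (intro conjI allI impI)
  fix S :: "'j set" and c :: "'j \<Rightarrow> real" assume S: "finite S"
  define d where "d i = c (inv T i)" for i
  have d: "d (T i) = c i" for i using T by (simp add: d_def)
  have inj: "inj_on T S" using T by (simp add: inj_on_def)
  have "(\<Sum>i\<in>S. c i * X (T i) w) = (\<Sum>i\<in>T ` S. d i * X i w)" for w
    using inj by (simp add: sum.reindex d)
  moreover have "quad_form (\<lambda>i j. K (T i) (T j)) S c c = quad_form K (T ` S) d d"
    using inj by (simp add: quad_form_def sum.reindex d)
  ultimately show "(CLINT w|M. cis (\<Sum>i\<in>S. c i * X (T i) w)) = exp (- quad_form (\<lambda>i j. K (T i) (T j)) S c c / 2)"
    using assms(1) S by (simp add: gaussian_cf_def)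
qed (use assms in \<open>simp add: gaussian_cf_def\<close>)

lemma gaussian_cf_uminus:
  fixes X :: "'i \<Rightarrow> 'w \<Rightarrow> real"
  assumes "gaussian_cf M X K"
  shows "gaussian_cf M (\<lambda>i w. - X i w) K"
  unfolding gaussian_cf_def
proof (intro conjI allI impI)
  fix S :: "'i set" and c assume S: "finite S"
  have "quad_form K S c c = quad_form K S (\<lambda>i. - c i) (\<lambda>i. - c i)"
    by (simp add: quad_form_def)
  then show "(CLINT w|M. cis (\<Sum>i\<in>S. c i * - X i w)) = exp (- quad_form K S c c / 2)"
    using assms S by (auto simp: gaussian_cf_def dest!: spec[of _ S] spec[of _ "\<lambda>i. - c i"])
qed (use assms in \<open>simp add: gaussian_cf_def\<close>)

lemma (in prob_space) gaussian_field_cf: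
  assumes G: "gaussian_field M f" and C: "centered_field M f" and K: "stationary_covariance M f \<kappa>"
  shows "gaussian_cf M f (\<lambda>x y. \<kappa> (x - y))"
proof -
  have g: "gaussian_rv M (\<lambda>w. \<Sum>x\<in>S. c x * f x w)" if "finite S" for S c
    using G that by (simp add: gaussian_field_def)
  have g1: "gaussian_rv M (f x)" for x using g[of "{x}" "\<lambda>_. 1"] by simp
  then have meas [measurable]: "f x \<in> borel_measurable M" for x by (simp add: gaussian_rv_def)
  have sq: "integrable M (\<lambda>w. (f x w)\<^sup>2)" for x
    using gaussian_rv_square_integrable[OF g1] .
  have int: "integrable M (f x)" for x
    by (rule square_integrable_imp_integrable[OF meas sq])
  \<comment> \<open>Products are dominated by the sum of the squares.\<close>
  have prod: "integrable M (\<lambda>w. f x w * f y w)" for x y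
  proof (rule Bochner_Integration.integrable_bound)
    show "integrable M (\<lambda>w. (f x w)\<^sup>2 + (f y w)\<^sup>2)" using sq by simp
    show "AE w in M. norm (f x w * f y w) \<le> norm ((f x w)\<^sup>2 + (f y w)\<^sup>2)"
    proof (rule AE_I2)
      fix w
      have "2 * \<bar>f x w\<bar> * \<bar>f y w\<bar> \<le> (f x w)\<^sup>2 + (f y w)\<^sup>2"
        using sum_squares_bound[of "\<bar>f x w\<bar>" "\<bar>f y w\<bar>"] by simp
      moreover have "0 \<le> \<bar>f x w\<bar> * \<bar>f y w\<bar>" by simp
      ultimately show "norm (f x w * f y w) \<le> norm ((f x w)\<^sup>2 + (f y w)\<^sup>2)" 
        unfolding real_norm_def abs_mult by linarith
    qed
  qed measurable
  show ?thesis unfolding gaussian_cf_def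
  proof (intro conjI allI impI meas)
    fix S :: "(real^2) set" and c assume S: "finite S"
    let ?X = "\<lambda>w. \<Sum>x\<in>S. c x * f x w"
    have "expectation ?X = 0"
      using int C by (simp add: centered_field_def Bochner_Integration.integral_sum)
    then have "(CLINT w|M. cis (?X w)) = exp (- expectation (\<lambda>w. (?X w)\<^sup>2) / 2)"
      by (rule gaussian_rv_cf[OF g[OF S]])
    also have "expectation (\<lambda>w. (?X w)\<^sup>2) = expectation (\<lambda>w. \<Sum>x\<in>S. \<Sum>y\<in>S. c x * c y * (f x w * f y w))"
      by (simp add: power2_eq_square sum_product ac_simps)
    also have "\<dots> = quad_form (\<lambda>x y. \<kappa> (x - y)) S c c"
      using prod K by (simp add: Bochner_Integration.integral_sum quad_form_def stationary_covariance_def)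
    finally show "(CLINT w|M. cis (?X w)) = exp (- quad_form (\<lambda>x y. \<kappa> (x - y)) S c c / 2)" .
  qed
qed

section \<open>Resampling along a Cameron--Martin direction\<close>

lemma quad_form_diff:
  assumes "\<And>i j. K i j = K j i"
  shows "quad_form K S (\<lambda>i. c i - s * d i) (\<lambda>i. c i - s * d i)
       = quad_form K S c c - 2 * s * quad_form K S c d + s\<^sup>2 * quad_form K S d d"
proof -
  have "quad_form K S d c = quad_form K S c d"
    unfolding quad_form_def by (subst sum.swap) (simp add: assms ac_simps)
  moreover have "quad_form K S (\<lambda>i. c i - s * d i) (\<lambda>i. c i - s * d i)
       = quad_form K S c c - s * quad_form K S c d - s * quad_form K S d c + s\<^sup>2 * quad_form K S d d"
    unfolding quad_form_def sum_distrib_left sum_subtractf[symmetric] sum.distrib[symmetric]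
    by (intro sum.cong refl) (simp add: algebra_simps power2_eq_square)
  ultimately show ?thesis by simp
qed

text \<open>Padding with zeros lets combinations over different index sets be compared over a common
  one.\<close>

lemma quad_form_restrict:
  assumes "finite T" "A \<subseteq> T" "B \<subseteq> T"
  shows "quad_form K T (\<lambda>i. if i \<in> A then c i else 0) (\<lambda>i. if i \<in> B then d i else 0)
       = (\<Sum>i\<in>A. \<Sum>j\<in>B. c i * d j * K i j)"
  unfolding quad_form_def using assms
  by (intro sum.mono_neutral_cong_right ballI) (auto intro!: sum.neutral sum.mono_neutral_cong_right)

text \<open>Splitting off the component along \<open>Z = (\<Sum>p\<in>P. X p)\<close> and resampling it independently does
  not change the law of a Gaussian process.\<close>

lemma gaussian_cf_resample:
  fixes X :: "'i \<Rightarrow> 'w \<Rightarrow> real"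
  assumes M: "prob_space M" and X: "gaussian_cf M X K" and sym: "\<And>i j. K i j = K j i"
    and P: "finite P"
    and h: "\<And>i. h i = (\<Sum>p\<in>P. K i p)" and v: "v = (\<Sum>p\<in>P. h p)" "0 < v"
  shows "gaussian_cf (M \<Otimes>\<^sub>M std_normal_distribution)
    (\<lambda>i (w, z). X i w - h i / v * (\<Sum>p\<in>P. X p w) + z * (h i / sqrt v)) K"
proof -
  interpret M: prob_space M by fact
  interpret N: real_distribution std_normal_distribution by (rule real_dist_normal_dist)
  interpret MN: pair_prob_space M std_normal_distribution ..
  have meas [measurable]: "X i \<in> borel_measurable M" for i using X by (simp add: gaussian_cf_def)
  show ?thesis unfolding gaussian_cf_def
  proof (intro conjI allI impI)
    fix S :: "'i set" and c assume S: "finite S"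
    define H where "H = (\<Sum>i\<in>S. c i * h i)"
    \<comment> \<open>Here \<open>h i\<close> is the covariance of \<open>X i\<close> with
      \<open>Z\<close>, \<open>v\<close> the variance of \<open>Z\<close>, and \<open>H\<close> the
      covariance of the given combination with \<open>Z\<close>. The \<open>c'\<close> are the
      coefficients of the combination minus its projection \<open>H / v * Z\<close>.\<close>
    define T where "T = S \<union> P"
    define c' where "c' i = (if i \<in> S then c i else 0) - H / v * (if i \<in> P then 1 else 0)" for i
    have T: "finite T" "S \<subseteq> T" "P \<subseteq> T" using S P by (auto simp: T_def)
    have G: "(\<Sum>i\<in>T. c' i * X i w) = (\<Sum>i\<in>S. c i * X i w) - H / v * (\<Sum>p\<in>P. X p w)" for w
    proof -
      have "(\<Sum>i\<in>S. c i * X i w) = (\<Sum>i\<in>T. (if i \<in> S then c i else 0) * X i w)"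
        using T by (intro sum.mono_neutral_cong_left) auto
      moreover have "(\<Sum>p\<in>P. X p w) = (\<Sum>i\<in>T. (if i \<in> P then 1 else 0) * X i w)"
        using T by (intro sum.mono_neutral_cong_left) auto
      ultimately show ?thesis
        by (simp add: c'_def left_diff_distrib sum_subtractf sum_distrib_left mult.assoc)
    qed
    \<comment> \<open>Removing the projection lowers the variance by exactly that of the independent
      term \<open>H / sqrt v * z\<close>.\<close>
    have q: "quad_form K T c' c' = quad_form K S c c - H\<^sup>2 / v"
    proof -
      have "quad_form K T (\<lambda>i. if i \<in> S then c i else 0) (\<lambda>i. if i \<in> S then c i else 0) = quad_form K S c c"
        using T by (subst quad_form_restrict) (auto simp: quad_form_def)
      moreover have "quad_form K T (\<lambda>i. if i \<in> S then c i else 0) (\<lambda>i. if i \<in> P then 1 else 0) = H"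
        using T by (subst quad_form_restrict) (auto simp: H_def h sum_distrib_left)
      moreover have "quad_form K T (\<lambda>i. if i \<in> P then 1 else 0) (\<lambda>i. if i \<in> P then 1 else 0) = v"
        using T by (subst quad_form_restrict) (auto simp: v h)
      ultimately show ?thesis unfolding c'_def quad_form_diff[OF sym]
        using v(2) by (simp add: field_simps power2_eq_square)
    qed
    have split: "(\<Sum>i\<in>S. c i * (X i w - h i / v * (\<Sum>p\<in>P. X p w) + z * (h i / sqrt v)))
       = (\<Sum>i\<in>T. c' i * X i w) + H / sqrt v * z" for w z
      unfolding G H_def
      by (simp add: distrib_left right_diff_distrib sum.distrib sum_subtractf sum_distrib_left
          sum_distrib_right sum_divide_distrib ac_simps)
    have "(CLINT wz|M \<Otimes>\<^sub>M std_normal_distribution. cis (\<Sum>i\<in>S. c i *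
        (case wz of (w, z) \<Rightarrow> X i w - h i / v * (\<Sum>p\<in>P. X p w) + z * (h i / sqrt v))))
      = (CLINT wz|M \<Otimes>\<^sub>M std_normal_distribution. case wz of (w, z) \<Rightarrow> cis (\<Sum>i\<in>T. c' i * X i w) * cis (H / sqrt v * z))"
      by (intro Bochner_Integration.integral_cong refl) (simp only: split_beta split cis_mult)
    also have "\<dots> = (CLINT w|M. CLINT z|std_normal_distribution. cis (\<Sum>i\<in>T. c' i * X i w) * cis (H / sqrt v * z))"
      by (subst MN.integral_fst'[symmetric]) (auto intro!: MN.P.integrable_const_bound[of _ 1] simp: norm_mult split_beta)
    also have "\<dots> = (CLINT w|M. cis (\<Sum>i\<in>T. c' i * X i w)) * char std_normal_distribution (H / sqrt v)"
      by (simp add: char_def cis_conv_exp)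
    also have "\<dots> = exp (- quad_form K T c' c' / 2) * exp (- (H / sqrt v)\<^sup>2 / 2)"
      using X T by (simp add: gaussian_cf_def char_std_normal_distribution flip: exp_of_real)
    also have "\<dots> = exp (- quad_form K S c c / 2)"
      unfolding q using v(2) by (simp add: power_divide field_simps flip: exp_add of_real_add of_real_minus)
    finally show "(CLINT wz|M \<Otimes>\<^sub>M std_normal_distribution. cis (\<Sum>i\<in>S. c i *
        (case wz of (w, z) \<Rightarrow> X i w - h i / v * (\<Sum>p\<in>P. X p w) + z * (h i / sqrt v))))
      = exp (- quad_form K S c c / 2)" .
  qed measurable
qed

text \<open>After resampling, for each fixed value of the remaining randomness at most one value of the
  new Gaussian variable \<open>z\<close> is exceptional, because the process is increasing in \<open>z\<close>.\<close>

lemma gaussian_no_jump: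
  fixes X :: "'i \<Rightarrow> 'w \<Rightarrow> real"
  assumes M: "prob_space M" and X: "gaussian_cf M X K" and sym: "\<And>i j. K i j = K j i"
    and P: "finite P"
    and h: "\<And>i. h i = (\<Sum>p\<in>P. K i p)" and v: "0 < (\<Sum>p\<in>P. h p)" and h0: "\<And>i. 0 \<le> h i"
    and meas [measurable]: "Measurable.pred (Pi\<^sub>M UNIV (\<lambda>_. borel)) \<Phi>"
    and mono: "\<And>u u'. \<Phi> u' \<Longrightarrow> (\<And>i. u i \<le> u' i) \<Longrightarrow> \<Phi> u"
  shows "AE w in M. (\<forall>n. \<Phi> (\<lambda>i. X i w - h i / Suc n)) \<longrightarrow> \<Phi> (\<lambda>i. X i w)"
proof -
  interpret M: prob_space M by fact
  interpret N: real_distribution std_normal_distribution by (rule real_dist_normal_dist)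
  interpret MN: pair_prob_space M std_normal_distribution ..
  let ?N = "M \<Otimes>\<^sub>M std_normal_distribution"
  let ?\<Pi> = "Pi\<^sub>M UNIV (\<lambda>_. borel) :: ('i \<Rightarrow> real) measure"
  define v where "v = (\<Sum>p\<in>P. h p)"
  have v0: "0 < v" using v by (simp add: v_def)
  define Y where "Y = (\<lambda>i (w, z). X i w - h i / v * (\<Sum>p\<in>P. X p w) + z * (h i / sqrt v))"
  have Ycf: "gaussian_cf ?N Y K"
    unfolding Y_def by (rule gaussian_cf_resample[OF M X sym P h v_def v0])
  have mX [measurable]: "X i \<in> borel_measurable M" for i using X by (simp add: gaussian_cf_def)
  have mY [measurable]: "Y i \<in> borel_measurable ?N" for i using Ycf by (simp add: gaussian_cf_def)
  have [measurable]: "(\<lambda>w i. X i w) \<in> measurable M ?\<Pi>" "(\<lambda>w i. Y i w) \<in> measurable ?N ?\<Pi>"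
    by (rule measurable_PiM_single'; simp)+
  have [measurable]: "(\<lambda>u i. u i - h i / Suc n) \<in> measurable ?\<Pi> ?\<Pi>" for n
    by (rule measurable_PiM_single'; simp)
  \<comment> \<open>The good event is shown to be almost sure for \<open>Y\<close> and carried over
    to \<open>X\<close> by equality of laws.\<close>
  define G where "G u \<longleftrightarrow> ((\<forall>n. \<Phi> (\<lambda>i. u i - h i / Suc n)) \<longrightarrow> \<Phi> u)" for u
  have [measurable]: "Measurable.pred ?\<Pi> G"
    unfolding G_def by measurable
  have law: "distr M ?\<Pi> (\<lambda>w i. X i w) = distr ?N ?\<Pi> (\<lambda>w i. Y i w)"
    by (rule gaussian_cf_law_unique[OF M MN.P.prob_space_axioms X Ycf])
  have "AE wz in ?N. G (\<lambda>i. Y i wz)"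
  proof (rule MN.AE_pair_measure)
    show "AE w in M. AE z in std_normal_distribution. G (\<lambda>i. Y i (w, z))"
    proof (rule AE_I2)
      fix w
      have unique: "z' = z" if z: "\<not> G (\<lambda>i. Y i (w, z))" "\<not> G (\<lambda>i. Y i (w, z'))" for z z'
      proof -
        \<comment> \<open>Passing from \<open>z\<close> to \<open>z'\<close> raises the process by
          \<open>h i * (z' - z) / sqrt v\<close>, which exceeds or equals \<open>h i / Suc n\<close>
          for large \<open>n\<close>. If both values were exceptional, \<open>\<Phi>\<close> at
          \<open>z'\<close> lowered by this amount would give \<open>\<Phi>\<close> at
          \<open>z\<close>.\<close>
        have False if lt: "z < z'" and nz: "\<not> \<Phi> (\<lambda>i. Y i (w, z))"
          and z': "\<And>n. \<Phi> (\<lambda>i. Y i (w, z') - h i / Suc n)" for z z'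
        proof -
          have "0 < (z' - z) / sqrt v" using lt v0 by simp
          then obtain n where n: "1 / Suc n < (z' - z) / sqrt v" using nat_approx_posE by metis
          have "Y i (w, z) \<le> Y i (w, z') - h i / Suc n" for i
          proof -
            have "h i / Suc n \<le> h i * ((z' - z) / sqrt v)"
              using mult_left_mono[OF less_imp_le[OF n] h0[of i]] by simp
            then show ?thesis by (simp add: Y_def diff_divide_distrib right_diff_distrib ac_simps)
          qed
          with z'[of n] have "\<Phi> (\<lambda>i. Y i (w, z))" by (rule mono)
          with nz show False by simp
        qed
        then show ?thesis using z unfolding G_def by (metis linorder_less_linear)
      qed
      show "AE z in std_normal_distribution. G (\<lambda>i. Y i (w, z))"
      proof (cases "\<exists>z. \<not> G (\<lambda>i. Y i (w, z))")
        case True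
        then obtain z0 where "\<And>z. z \<noteq> z0 \<Longrightarrow> G (\<lambda>i. Y i (w, z))" using unique by metis
        \<comment> \<open>The normal law has no atoms.\<close>
        moreover have "AE z in std_normal_distribution. z \<noteq> z0"
          using AE_lborel_singleton[of z0] by (auto simp: AE_density)
        ultimately show ?thesis by (auto elim: eventually_mono)
      qed simp
    qed
  qed measurable
  then have "AE u in distr ?N ?\<Pi> (\<lambda>w i. Y i w). G u"
    by (subst AE_distr_iff) auto
  then have "AE w in M. G (\<lambda>i. X i w)"
    unfolding law[symmetric] by (subst (asm) AE_distr_iff) auto
  then show ?thesis by (simp add: G_def)
qed

section \<open>The arm probability\<close>

text \<open>\<open>\<kappa>\<close> is positive near 0, finitely many translates of that
  neighbourhood cover the ball, and nonnegativity prevents cancellation. The double sum is the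
  variance by which the resampling divides.\<close>

lemma potential_pos:
  fixes \<kappa> :: "'a::{heine_borel, real_normed_vector} \<Rightarrow> real"
  assumes cont: "continuous_on UNIV \<kappa>" and nn: "\<And>x. 0 \<le> \<kappa> x" and pos: "0 < \<kappa> 0" and B: "0 \<le> B"
  obtains P where "finite P" "\<And>x. x \<in> cball 0 B \<Longrightarrow> 0 < (\<Sum>p\<in>P. \<kappa> (x - p))"
    "0 < (\<Sum>q\<in>P. \<Sum>p\<in>P. \<kappa> (q - p))"
proof -
  have op: "open {x. 0 < \<kappa> x}"
    using open_Collect_less[of "\<lambda>_. 0" \<kappa>] cont by simp
  obtain \<delta> where \<delta>: "0 < \<delta>" "ball 0 \<delta> \<subseteq> {x. 0 < \<kappa> x}"
    using openE[OF op, of 0] pos by (metis mem_Collect_eq)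
  have cov: "cball 0 B \<subseteq> (\<Union>p\<in>cball (0::'a) B. ball p \<delta>)" using \<delta>(1) centre_in_ball by blast
  obtain P where "P \<subseteq> cball (0::'a) B" and P: "finite P" "cball 0 B \<subseteq> (\<Union>p\<in>P. ball p \<delta>)"
    by (rule compactE_image[OF compact_cball open_ball cov])
  have ge: "0 < (\<Sum>p\<in>P. \<kappa> (x - p))" if "p \<in> P" "x \<in> ball p \<delta>" for x p
  proof -
    have "x - p \<in> ball 0 \<delta>" using that by (simp add: dist_norm norm_minus_commute)
    then show ?thesis using \<delta> P that nn by (intro sum_pos2[of P p]) auto
  qed
  show thesis
  proof
    show "0 < (\<Sum>p\<in>P. \<kappa> (x - p))" if "x \<in> cball 0 B" for x
      using that P ge by blast
    obtain p where "p \<in> P" using P(2) B by (metis UN_E centre_in_cball subsetD)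
    then have "P \<noteq> {}" by blast
    moreover have "0 < (\<Sum>p\<in>P. \<kappa> (q - p))" if "q \<in> P" for q
      using ge[OF that, of q] \<delta>(1) by simp
    ultimately show "0 < (\<Sum>q\<in>P. \<Sum>p\<in>P. \<kappa> (q - p))"
      using P(1) by (rule sum_pos[rotated])
  qed (use P in auto)
qed

lemma measurable_shift:
  "(\<lambda>u x. u (x + a)) \<in> measurable (Pi\<^sub>M UNIV (\<lambda>_. borel)) (Pi\<^sub>M UNIV (\<lambda>_. borel :: real measure))"
  by (rule measurable_PiM_single'; simp)

lemma measurable_arm_process:
  assumes "gaussian_cf M X K"
  shows "Measurable.pred M (\<lambda>w. arm R (\<lambda>x. X (x + a) w))" "Measurable.pred M (\<lambda>w. arm R (\<lambda>x. X x w))"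
proof -
  have [measurable]: "X i \<in> borel_measurable M" for i using assms by (simp add: gaussian_cf_def)
  have [measurable]: "(\<lambda>w x. X (x + a) w) \<in> measurable M (Pi\<^sub>M UNIV (\<lambda>_. borel))" for a
    by (rule measurable_PiM_single'; simp)
  have "Measurable.pred M (\<lambda>w. arm R (\<lambda>x. X (x + a) w))" for a
    by (rule measurable_compose[OF _ measurable_arm]) fact
  from this[of a] this[of 0] show "Measurable.pred M (\<lambda>w. arm R (\<lambda>x. X (x + a) w))" 
    "Measurable.pred M (\<lambda>w. arm R (\<lambda>x. X x w))" by simp_all
qed

lemma square_crossing_arm:
  assumes g: "path g" "path_image g \<subseteq> cbox 0 (vec R)" and ends: "pathstart g $ i = 0" "pathfinish g $ i = R"
    and u: "continuous_on UNIV u" "\<And>x. x \<in> path_image g \<Longrightarrow> u x < 0"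
  shows "\<exists>j\<le>nat \<lceil>R\<rceil>. arm R (\<lambda>x. u (x + axis (i + 1) (real j)))"
proof -
  \<comment> \<open>In the two-element index type \<open>i + 1\<close> is the other coordinate, the
    one running along the starting side.\<close>
  have ne: "i + 1 \<noteq> i" for i :: 2 by simp
  have oth: "k = i \<or> k = i + 1" for k :: 2 
    using exhaust_2[of k] exhaust_2[of i] by auto
  define s where "s = pathstart g"
  have s: "s \<in> cbox 0 (vec R)" using g unfolding s_def by blast
  \<comment> \<open>Rounding down the position on the side gives a lattice point at distance at most
    1 from the start; the end stays at distance at least \<open>R\<close> because of coordinate
    \<open>i\<close>.\<close>
  define j where "j = nat \<lfloor>s $ (i + 1)\<rfloor>"
  define a where "a = axis (i + 1) (real j)"
  have s1: "0 \<le> s $ (i + 1)" "s $ (i + 1) \<le> R" using s by (auto simp: mem_box_cart)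
  have jR: "j \<le> nat \<lceil>R\<rceil>"
    unfolding j_def using s1 by (intro nat_mono) linarith
  have "norm (s - a) \<le> (\<Sum>k\<in>UNIV. \<bar>(s - a) $ k\<bar>)" by (rule norm_le_l1_cart)
  also have "\<dots> = (\<Sum>k\<in>{i, i + 1}. \<bar>(s - a) $ k\<bar>)"
    using oth by (intro sum.cong) auto
  also have "\<dots> = \<bar>s $ (i + 1) - real j\<bar>"
    using ne[of i] ends by (simp add: s_def a_def axis_def)
  also have "\<dots> \<le> 1" unfolding j_def using s1 by linarith
  finally have start: "norm (s - a) \<le> 1" .
  have "R = (pathfinish g - a) $ i" using ends ne[of i] by (simp add: a_def axis_def)
  also have "\<dots> \<le> norm (pathfinish g - a)" 
    using component_le_norm_cart[of "pathfinish g - a" i] by linarith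
  finally have fin: "R \<le> norm (pathfinish g - a)" .
  have "arm R (\<lambda>x. u (x + a))"
  proof (rule path_imp_arm[of "\<lambda>t. g t - a"])
    show "path (\<lambda>t. g t - a)" using g unfolding path_def by (intro continuous_intros)
    show "norm (pathstart (\<lambda>t. g t - a)) \<le> 1" using start by (simp add: s_def pathstart_def)
    show "R \<le> norm (pathfinish (\<lambda>t. g t - a))" using fin by (simp add: pathfinish_def)
    show "continuous_on UNIV (\<lambda>x. u (x + a))"
      by (intro continuous_on_compose2[OF u(1)] continuous_intros) auto
    show "u (x + a) < 0" if "x \<in> path_image (\<lambda>t. g t - a)" for x
      using that u(2) by (auto simp: path_image_def)
  qed
  with jR show ?thesis unfolding a_def by blast
qed

section \<open>Arm probabilities of the field\<close>

locale positively_correlated_field = prob_space M for M :: "'w measure" +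
  fixes f :: "real^2 \<Rightarrow> 'w \<Rightarrow> real" and \<kappa> :: "real^2 \<Rightarrow> real"
  assumes cf: "gaussian_cf M f (\<lambda>x y. \<kappa> (x - y))"
    and cov_sym: "\<kappa> (- x) = \<kappa> x"
    and cov_cont: "continuous_on UNIV \<kappa>"
    and cov_nonneg: "0 \<le> \<kappa> x"
    and cov_0: "0 < \<kappa> 0"
    and sample_cont: "AE w in M. continuous_on UNIV (\<lambda>x. f x w)"
begin

text \<open>The covariance depends only on \<open>x - y\<close>, so a translate of \<open>X\<close>
  has the law of \<open>f\<close>. Both \<open>f\<close> and its negative serve as
  \<open>X\<close>.\<close>

lemma prob_arm_invariant:
  assumes X: "gaussian_cf M X (\<lambda>x y. \<kappa> (x - y))"
  shows "prob {w \<in> space M. arm R (\<lambda>x. X (x + a) w)} = prob {w \<in> space M. arm R (\<lambda>x. f x w)}"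
proof -
  let ?\<Pi> = "Pi\<^sub>M UNIV (\<lambda>_. borel) :: (real^2 \<Rightarrow> real) measure"
  have X': "gaussian_cf M (\<lambda>x. X (x + a)) (\<lambda>x y. \<kappa> (x - y))"
    using gaussian_cf_reindex[OF X, of "\<lambda>x. x + a"] by (simp add: inj_def)
  have law: "distr M ?\<Pi> (\<lambda>w x. X (x + a) w) = distr M ?\<Pi> (\<lambda>w x. f x w)"
    by (rule gaussian_cf_law_unique[OF prob_space_axioms prob_space_axioms X' cf])
  have [measurable]: "X i \<in> borel_measurable M" "f i \<in> borel_measurable M" for i
    using X cf by (simp_all add: gaussian_cf_def)
  have [measurable]: "(\<lambda>w x. X (x + a) w) \<in> measurable M ?\<Pi>" "(\<lambda>w x. f x w) \<in> measurable M ?\<Pi>"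
    by (rule measurable_PiM_single'; simp)+
  have A: "{u. arm R u} \<in> sets ?\<Pi>"
    using measurable_arm[of R] by (simp add: pred_def space_PiM)
  have "prob {w \<in> space M. arm R (\<lambda>x. X (x + a) w)} = measure (distr M ?\<Pi> (\<lambda>w x. X (x + a) w)) {u. arm R u}"
    using A by (subst measure_distr) (auto intro!: arg_cong[where f=prob])
  also have "\<dots> = prob {w \<in> space M. arm R (\<lambda>x. f x w)}"
    unfolding law using A by (subst measure_distr) (auto intro!: arg_cong[where f=prob])
  finally show ?thesis .
qed

lemma arm_no_jump:
  assumes X: "gaussian_cf M X (\<lambda>x y. \<kappa> (x - y))" and P: "finite P" 
    and v: "0 < (\<Sum>q\<in>P. \<Sum>p\<in>P. \<kappa> (q - p))"
  shows "AE w in M. (\<forall>n. arm R (\<lambda>x. X (x + a) w - (\<Sum>p\<in>P. \<kappa> (x + a - p)) / Suc n))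
    \<longrightarrow> arm R (\<lambda>x. X (x + a) w)"
proof (rule gaussian_no_jump[OF prob_space_axioms X _ P refl v, where \<Phi>="\<lambda>u. arm R (\<lambda>x. u (x + a))"])
  show "\<kappa> (x - y) = \<kappa> (y - x)" for x y using cov_sym[of "x - y"] by simp
  show "0 \<le> (\<Sum>p\<in>P. \<kappa> (x - p))" for x using cov_nonneg by (intro sum_nonneg)
  show "Measurable.pred (Pi\<^sub>M UNIV (\<lambda>_. borel)) (\<lambda>u::real^2 \<Rightarrow> real. arm R (\<lambda>x. u (x + a)))"
    by (rule measurable_compose[OF measurable_shift measurable_arm])
qed (rule arm_antimono)

text \<open>The upper inclusion holds because a path in the closed set \<open>{f \<le> 0}\<close> lies in each of the
  open sets \<open>{f < h / n}\<close>.\<close>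

lemma AE_cross0_iff_arm:
  assumes R: "1 < R"
  shows "AE w in M. w \<in> cross0 M f R \<longleftrightarrow> arm R (\<lambda>x. f x w)"
proof -
  obtain P where P: "finite P" "\<And>x. x \<in> cball 0 R \<Longrightarrow> 0 < (\<Sum>p\<in>P. \<kappa> (x - p))"
    "0 < (\<Sum>q\<in>P. \<Sum>p\<in>P. \<kappa> (q - p))"
    using potential_pos[OF cov_cont cov_nonneg cov_0, of R] R by auto
  have le0: "sigma0 f w x = 0 \<longleftrightarrow> f x w \<le> 0" for w x
    by (simp add: sigma0_def sign_neg_def)
  show ?thesis
    using sample_cont arm_no_jump[OF cf P(1,3), of R 0] AE_space
  proof eventually_elim
    case (elim w)
    show ?case
    proof
      assume "w \<in> cross0 M f R"
      then obtain g where g: "path g" "path_image g \<subseteq> {x. f x w \<le> 0}"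
        "pathstart g \<in> sphere 0 1" "pathfinish g \<in> sphere 0 R"
        by (auto simp: cross0_def le0)
      \<comment> \<open>The path may leave the ball on which the potential is known to be positive,
        so it is first trimmed.\<close>
      obtain k where k: "path k" "path_image k \<subseteq> path_image g \<inter> cball 0 R"
        "pathstart k \<in> sphere 0 1" "pathfinish k \<in> sphere 0 R"
        by (rule path_crossing_annulus[of g 0 1 R]) (use g R in simp_all)
      have "arm R (\<lambda>x. f x w - (\<Sum>p\<in>P. \<kappa> (x - p)) / Suc n)" for n
      proof (rule path_imp_arm[OF k(1)])
        show "continuous_on UNIV (\<lambda>x. f x w - (\<Sum>p\<in>P. \<kappa> (x - p)) / Suc n)"
          by (intro continuous_intros elim continuous_on_compose2[OF cov_cont]) auto
        fix x assume "x \<in> path_image k"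
        then have "f x w \<le> 0" "0 < (\<Sum>p\<in>P. \<kappa> (x - p)) / Suc n"
          using k(2) g(2) P(2)[of x] by auto
        then show "f x w - (\<Sum>p\<in>P. \<kappa> (x - p)) / Suc n < 0" by linarith
      qed (use k in auto)
      then show "arm R (\<lambda>x. f x w)" using elim(2) by simp
    next
      assume "arm R (\<lambda>x. f x w)"
      then obtain g where "path g" "path_image g \<subseteq> {x. f x w < 0}"
        "pathstart g \<in> sphere 0 1" "pathfinish g \<in> sphere 0 R"
        using arm_imp_path[OF elim(1) _ R] by blast
      then show "w \<in> cross0 M f R"
        using elim(3) by (auto simp: cross0_def le0 subset_eq intro!: exI[of _ g] less_imp_le)
    qed
  qed
qed

text \<open>The crossing event differs from the measurable arm event by a null set, hence is
  measurable in the completion.\<close>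

lemma prob_cross0_eq_prob_arm:
  assumes R: "1 < R"
  shows "prob_cross0 M f R = prob {w \<in> space M. arm R (\<lambda>x. f x w)}"
proof -
  let ?A = "{w \<in> space M. arm R (\<lambda>x. f x w)}"
  have A: "?A \<in> sets M" using measurable_arm_process(2)[OF cf] by (simp add: pred_def)
  have ae: "AE w in completion M. w \<in> ?A \<longleftrightarrow> w \<in> cross0 M f R"
    using AE_cross0_iff_arm[OF R] by (intro AE_completion) (auto elim!: eventually_mono simp: cross0_def)
  have C: "cross0 M f R \<in> sets (completion M)"
    by (rule completion.in_sets_AE[OF ae]) (use A in \<open>auto simp: cross0_def\<close>)
  have "measure (completion M) (cross0 M f R) = measure (completion M) ?A"
    using ae A C by (intro measure_eq_AE) (auto elim: eventually_mono)
  then show ?thesis using A by (simp add: prob_cross0_def)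
qed

lemma prob_arm_lower_bound:
  assumes R: "1 < R"
  shows "1 \<le> 2 * (real (nat \<lceil>R\<rceil>) + 1) * prob {w \<in> space M. arm R (\<lambda>x. f x w)}"
proof -
  \<comment> \<open>The square of side \<open>R\<close> with a corner at 0 lies in the ball of
    radius \<open>2 * R\<close>.\<close>
  obtain P where P: "finite P" "\<And>x. x \<in> cball 0 (2 * R) \<Longrightarrow> 0 < (\<Sum>p\<in>P. \<kappa> (x - p))"
    "0 < (\<Sum>q\<in>P. \<Sum>p\<in>P. \<kappa> (q - p))"
    using potential_pos[OF cov_cont cov_nonneg cov_0, of "2 * R"] R by auto
  define h where "h x = (\<Sum>p\<in>P. \<kappa> (x - p))" for x
  have h_nonneg: "0 \<le> h x" for x unfolding h_def using cov_nonneg by (intro sum_nonneg)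
  have h_cont: "continuous_on UNIV h"
    unfolding h_def by (intro continuous_intros continuous_on_compose2[OF cov_cont]) auto
  have h_pos: "0 < h x" if "x \<in> cbox 0 (vec R)" for x
  proof -
    have "norm x \<le> \<bar>x $ 1\<bar> + \<bar>x $ 2\<bar>" using norm_le_l1_cart[of x] by (simp add: sum_2)
    moreover have "\<bar>x $ k\<bar> \<le> R" for k using that R by (auto simp: mem_box_cart)
    from this[of 1] this[of 2] have "\<bar>x $ 1\<bar> + \<bar>x $ 2\<bar> \<le> 2 * R" by linarith
    ultimately show ?thesis unfolding h_def by (intro P) simp
  qed
  define X :: "2 \<Rightarrow> real^2 \<Rightarrow> 'w \<Rightarrow> real" where "X i = (if i = 1 then f else (\<lambda>x w. - f x w))" for i
  have X: "gaussian_cf M (X i) (\<lambda>x y. \<kappa> (x - y))" for i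
    using cf gaussian_cf_uminus[OF cf] by (auto simp: X_def)
  define a where "a = (\<lambda>(i::2, j). axis (i + 1) (real j) :: real^2)"
  define I where "I = (UNIV :: 2 set) \<times> {..nat \<lceil>R\<rceil>}"
  have I: "finite I" by (simp add: I_def)
  define A where "A k = {w \<in> space M. arm R (\<lambda>x. X (fst k) (x + a k) w)}" for k
  have A: "A k \<in> events" for k
    unfolding A_def using measurable_arm_process(1)[OF X] by (simp add: pred_def)
  have nj: "AE w in M. \<forall>k\<in>I. (\<forall>n. arm R (\<lambda>x. X (fst k) (x + a k) w - h (x + a k) / Suc n))
    \<longrightarrow> arm R (\<lambda>x. X (fst k) (x + a k) w)"
    unfolding h_def using I arm_no_jump[OF X P(1,3)] by (intro AE_finite_allI) auto
  have "AE w in M. w \<in> (\<Union>k\<in>I. A k)"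
    using sample_cont nj AE_space
  proof eventually_elim
    case (elim w)
    have X_cont: "continuous_on UNIV (\<lambda>x. X i x w)" for i
      using elim(1) by (auto simp: X_def intro: continuous_intros)
    define E where "E n k \<longleftrightarrow> arm R (\<lambda>x. X (fst k) (x + a k) w - h (x + a k) / Suc n)" for n k
    have E_mono: "E m k" if "E n k" "m \<le> n" for m n k
      using that(1) unfolding E_def
      by (rule arm_antimono) (use that(2) h_nonneg in \<open>auto intro!: divide_left_mono\<close>)
    have ex: "\<exists>k\<in>I. E n k" for n
    proof -
      \<comment> \<open>The sets \<open>{x. 0 < b i x}\<close> cover the square, since
        \<open>f\<close> and \<open>- f\<close> cannot both be at least the positive number
        \<open>h x / Suc n\<close>.\<close>
      define b where "b i x = max 0 (h x / Suc n - X i x w)" for i x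
      obtain i g where g: "path g" "path_image g \<subseteq> {x \<in> cbox 0 (vec R). 0 < b i x}"
        "pathstart g $ i = 0" "pathfinish g $ i = R"
      proof (rule square_crossing[of R b])
        show "continuous_on (cbox 0 (vec R)) (b i)" for i
          unfolding b_def
          by (intro continuous_intros continuous_on_subset[OF h_cont] continuous_on_subset[OF X_cont]) auto
        fix x :: "real^2" assume "x \<in> cbox 0 (vec R)"
        then have "0 < h x / Suc n" using h_pos by simp
        then have "0 < b 1 x \<or> 0 < b 2 x" by (auto simp: b_def X_def less_max_iff_disj)
        then show "\<exists>i. 0 < b i x" by blast
      qed (use R in \<open>auto simp: b_def\<close>)
      have "\<exists>j\<le>nat \<lceil>R\<rceil>. arm R (\<lambda>x. X i (x + axis (i + 1) (real j)) w - h (x + axis (i + 1) (real j)) / Suc n)"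
      proof (rule square_crossing_arm[OF g(1) _ g(3,4), of "\<lambda>x. X i x w - h x / Suc n"])
        show "continuous_on UNIV (\<lambda>x. X i x w - h x / Suc n)"
          by (intro continuous_intros X_cont h_cont) auto
        fix x assume "x \<in> path_image g"
        then have "0 < b i x" using g(2) by blast
        then show "X i x w - h x / Suc n < 0" by (simp add: b_def less_max_iff_disj)
      qed (use g(2) in blast)
      then show ?thesis by (auto simp: E_def I_def a_def)
    qed
    \<comment> \<open>The direction and starting point found above may vary with \<open>n\<close>.
      As \<open>I\<close> is finite and \<open>E n k\<close> weakens as \<open>n\<close> decreases,
      one choice works for all \<open>n\<close>.\<close>
    have "\<exists>k\<in>I. \<forall>n. E n k"
    proof (rule ccontr)
      assume "\<not> (\<exists>k\<in>I. \<forall>n. E n k)"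
      then have "\<forall>k\<in>I. \<forall>\<^sub>F n in sequentially. \<not> E n k"
        unfolding eventually_sequentially using E_mono by meson
      then have "\<forall>\<^sub>F n in sequentially. \<forall>k\<in>I. \<not> E n k" using I by (simp add: eventually_ball_finite)
      then show False using ex by (auto simp: eventually_sequentially)
    qed
    then show ?case using elim(2,3) by (auto simp: E_def A_def)
  qed
  moreover have "(\<Union>k\<in>I. A k) \<in> events" using A I by (intro sets.finite_UN) auto
  ultimately have "prob (\<Union>k\<in>I. A k) = 1" by (simp only: prob_eq_1)
  then have "1 \<le> prob (\<Union>k\<in>I. A k)" by simp
  also have "\<dots> \<le> (\<Sum>k\<in>I. prob (A k))"
    using A I by (intro measure_UNION_le) auto
  also have "\<dots> = (\<Sum>k\<in>I. prob {w \<in> space M. arm R (\<lambda>x. f x w)})"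
    unfolding A_def using prob_arm_invariant[OF X] by simp
  also have "\<dots> = 2 * (real (nat \<lceil>R\<rceil>) + 1) * prob {w \<in> space M. arm R (\<lambda>x. f x w)}"
    by (simp add: I_def card_cartesian_product)
  finally show ?thesis .
qed

end

theorem corollary3p6:
  fixes M :: "'w measure"
    and f :: "real^2 \<Rightarrow> 'w \<Rightarrow> real"
    and \<kappa> \<rho> q :: "real^2 \<Rightarrow> real"
  assumes "prob_space M"
    and "gaussian_field M f"
    and "AE \<omega> in M. continuous_on UNIV (\<lambda>x. f x \<omega>)"
    and "continuous_on UNIV \<kappa>"
    and "\<rho> \<in> borel_measurable borel"
    and "is_spectral_measure (density lborel (\<lambda>\<xi>. ennreal ((\<rho> \<xi>)\<^sup>2))) \<kappa>"
    and "is_fourier_L2 \<rho> q"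
    and "\<kappa> = convolve q q"
    and "symmetries M f \<kappa>"
    and "strong_regularity \<rho> q"
    and "weak_positivity \<kappa>"
    and "strong_decay q"
  shows "\<forall>\<eta>>0. Limsup at_top (\<lambda>R::real. ereal (R powr (1 + \<eta>) * prob_cross0 M f R)) > 0"
proof (intro allI impI)
  fix \<eta> :: real assume \<eta>: "0 < \<eta>"
  have sym: "centered_field M f" "stationary_covariance M f \<kappa>" "\<kappa> 0 = 1"
    using assms(9) by (auto simp: symmetries_def)
  interpret prob_space M by fact
  interpret positively_correlated_field M f \<kappa>
  proof
    show "gaussian_cf M f (\<lambda>x y. \<kappa> (x - y))"
      by (rule gaussian_field_cf[OF assms(2) sym(1,2)])
    \<comment> \<open>The expectation of a product is symmetric in its two factors.\<close>
    have "\<kappa> (0 - x) = \<kappa> (x - 0)" for x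
      using sym(2) by (metis (no_types, lifting) stationary_covariance_def mult.commute
          Bochner_Integration.integral_cong)
    then show "\<kappa> (- x) = \<kappa> x" for x by simp
    show "0 \<le> \<kappa> x" for x using assms(11) by (simp add: weak_positivity_def)
  qed (use assms sym in auto)
  \<comment> \<open>For \<open>R > 1\<close> the number of events in the union bound,
    \<open>2 * (\<lceil>R\<rceil> + 1)\<close>, is at most \<open>2 * (R + 2) \<le> 6 * R\<close>,
    and \<open>R \<le> R powr (1 + \<eta>)\<close>.\<close>
  have "1 / 6 \<le> R powr (1 + \<eta>) * prob_cross0 M f R" if R: "R > 1" for R
  proof -
    have "1 \<le> 2 * (real (nat \<lceil>R\<rceil>) + 1) * prob_cross0 M f R"
      using prob_arm_lower_bound[OF R] by (simp only: prob_cross0_eq_prob_arm[OF R])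
    also have "\<dots> \<le> (6 * R) * prob_cross0 M f R"
      by (intro mult_right_mono) (use R in \<open>linarith | simp add: prob_cross0_def\<close>)+
    also have "\<dots> \<le> 6 * (R powr (1 + \<eta>) * prob_cross0 M f R)"
      using R \<eta> powr_mono[of 1 "1 + \<eta>" R] by (simp add: mult_right_mono prob_cross0_def)
    finally show ?thesis by simp
  qed
  then have "\<forall>\<^sub>F R in at_top. ereal (1 / 6) \<le> ereal (R powr (1 + \<eta>) * prob_cross0 M f R)"
    by (intro eventually_mono[OF eventually_gt_at_top[of 1]]) simp
  then have "ereal (1 / 6) \<le> Limsup at_top (\<lambda>R::real. ereal (R powr (1 + \<eta>) * prob_cross0 M f R))"
    by (intro le_Limsup) auto
  then show "0 < Limsup at_top (\<lambda>R::real. ereal (R powr (1 + \<eta>) * prob_cross0 M f R))"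
    by (rule less_le_trans[rotated]) simp
qed

end
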